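(* Let $\mathcal{F}:\mathcal{U}\to\mathbb{R}_+$ be the functional $$\mathcal{F}(u):=\int_\Theta\int_0^1 a(t,x_u^\theta(t),\theta)\,d\nu(t)\,d\mu(\theta)+\frac{\beta}{2}\|u\|_{L^2}^2 .$$ Then there exists $\hat u\in\mathcal{U}$ such that $\mathcal{F}(\hat u)=\inf_{\mathcal{U}}\mathcal{F}$.
   Context: Let $n,k\ge 1$ and let $\Theta$ be a compact subset of a finite-dimensional Euclidean space. Let $F_0:\mathbb{R}^n\times\Theta\to\mathbb{R}^n$ and $F=(F_1,\dots,F_k):\mathbb{R}^n\times\Theta\to\mathbb{R}^{n\times k}$ ($F_i$ is the $i$-th column of $F$) be such that, for some $L>0$, $|F_i(x_1,\theta_1)-F_i(x_2,\theta_2)|_2\le L(|x_1-x_2|_2+|\theta_1-\theta_2|_2)$ for all $i=0,\dots,k$ and all $(x_1,\theta_1),(x_2,\theta_2)\in\mathbb{R}^n\times\Theta$. Let $x_0:\Theta\to\mathbb{R}^n$ be continuous. Set $\mathcal{U}:=L^2([0,1],\mathbb{R}^k)$. For $u\in\mathcal{U}$ and $\theta\in\Theta$, $x_u^\theta:[0,1]\to\mathbb{R}^n$ is the unique absolutely continuous solution of $\dot x(t)=F_0(x(t),\theta)+F(x(t),\theta)u(t)$ for a.e. $t\in[0,1]$, $x(0)=x_0(\theta)$. The function $a:[0,1]\times\mathbb{R}^n\times\Theta\to\mathbb{R}_+$ is continuous and non-negative, $\beta>0$, $\nu$ is a Borel probability measure on $[0,1]$ and $\mu$ is a Borel probability measure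 on $\Theta$. *)

theory Defs
  imports "HOL-Probability.Probability"
begin

definition absolutely_continuous_on_interval ::
    "real \<Rightarrow> real \<Rightarrow> (real \<Rightarrow> 'a::real_normed_vector) \<Rightarrow> bool" where
  "absolutely_continuous_on_interval a b f \<longleftrightarrow>
     (\<forall>\<epsilon>>0. \<exists>\<delta>>0. \<forall>(I :: nat set) l r.
        finite I \<longrightarrow>
        (\<forall>i\<in>I. a \<le> l i \<and> l i \<le> r i \<and> r i \<le> b) \<longrightarrow>
        disjoint_family_on (\<lambda>i. {l i<..<r i}) I \<longrightarrow>
        (\<Sum>i\<in>I. r i - l i) < \<delta> \<longrightarrow>
        (\<Sum>i\<in>I. norm (f (r i) - f (l i))) < \<epsilon>)"

(* Elements of L^2([0,1], R^k) are given by representatives: the values outside [0,1] are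
   irrelevant, and a.e. equal representatives have the same trajectories, norm and cost
   (trajectory_cong_AE, L2_norm_cong_AE and cost_cong_AE below). *)
definition L2_controls :: "(real \<Rightarrow> real^'k) set" where
  "L2_controls =
     {u. u \<in> borel_measurable (lebesgue_on {0..1}) \<and>
         integrable (lebesgue_on {0..1}) (\<lambda>t. (norm (u t))\<^sup>2)}"

definition L2_norm :: "(real \<Rightarrow> real^'k) \<Rightarrow> real" where
  "L2_norm u = sqrt (LINT t|lebesgue_on {0..1}. (norm (u t))\<^sup>2)"

definition is_trajectory ::
    "(real^'n \<Rightarrow> 'p \<Rightarrow> real^'n) \<Rightarrow> (real^'n \<Rightarrow> 'p \<Rightarrow> real^'k^'n) \<Rightarrow> ('p \<Rightarrow> real^'n) \<Rightarrow>
     (real \<Rightarrow> real^'k) \<Rightarrow> 'p \<Rightarrow> (real \<Rightarrow> real^'n) \<Rightarrow> bool" where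
  "is_trajectory F0 F x0 u \<theta> x \<longleftrightarrow>
     absolutely_continuous_on_interval 0 1 x \<and>
     x 0 = x0 \<theta> \<and>
     (AE t in lebesgue_on {0..1}.
        (x has_vector_derivative (F0 (x t) \<theta> + F (x t) \<theta> *v u t)) (at t within {0..1}))"

(* Restricting to extensional functions fixes the irrelevant values outside [0,1],
   so that the solution is unique as a total function. *)
definition trajectory ::
    "(real^'n \<Rightarrow> 'p \<Rightarrow> real^'n) \<Rightarrow> (real^'n \<Rightarrow> 'p \<Rightarrow> real^'k^'n) \<Rightarrow> ('p \<Rightarrow> real^'n) \<Rightarrow>
     (real \<Rightarrow> real^'k) \<Rightarrow> 'p \<Rightarrow> real \<Rightarrow> real^'n" where
  "trajectory F0 F x0 u \<theta> =
     (THE x. x \<in> extensional {0..1} \<and> is_trajectory F0 F x0 u \<theta> x)"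

definition cost ::
    "(real^'n \<Rightarrow> 'p \<Rightarrow> real^'n) \<Rightarrow> (real^'n \<Rightarrow> 'p \<Rightarrow> real^'k^'n) \<Rightarrow> ('p \<Rightarrow> real^'n) \<Rightarrow>
     (real \<Rightarrow> real^'n \<Rightarrow> 'p \<Rightarrow> real) \<Rightarrow> real \<Rightarrow> real measure \<Rightarrow> 'p measure \<Rightarrow>
     (real \<Rightarrow> real^'k) \<Rightarrow> real" where
  "cost F0 F x0 a \<beta> \<nu> \<mu> u =
     (LINT \<theta>|\<mu>. (LINT t|\<nu>. a t (trajectory F0 F x0 u \<theta> t) \<theta>)) + \<beta> / 2 * (L2_norm u)\<^sup>2"

lemma trajectory_cong_AE:
  assumes "AE t in lebesgue_on {0..1}. u t = v t"
  shows "trajectory F0 F x0 u \<theta> = trajectory F0 F x0 v \<theta>"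
proof -
  have "(AE t in lebesgue_on {0..1}.
          (x has_vector_derivative (F0 (x t) \<theta> + F (x t) \<theta> *v u t)) (at t within {0..1})) \<longleftrightarrow>
        (AE t in lebesgue_on {0..1}.
          (x has_vector_derivative (F0 (x t) \<theta> + F (x t) \<theta> *v v t)) (at t within {0..1}))" for x
    using assms by (intro iffI; elim AE_mp; auto intro: AE_mp)
  then show ?thesis
    unfolding trajectory_def is_trajectory_def by simp
qed

lemma L2_norm_cong_AE:
  assumes "u \<in> L2_controls" "v \<in> L2_controls" "AE t in lebesgue_on {0..1}. u t = v t"
  shows "L2_norm u = L2_norm v"
proof -
  have "(LINT t|lebesgue_on {0..1}. (norm (u t))\<^sup>2) = (LINT t|lebesgue_on {0..1}. (norm (v t))\<^sup>2)"
    using assms by (intro integral_cong_AE) (auto simp: L2_controls_def)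
  then show ?thesis
    by (simp add: L2_norm_def)
qed

lemma cost_cong_AE:
  assumes "u \<in> L2_controls" "v \<in> L2_controls" "AE t in lebesgue_on {0..1}. u t = v t"
  shows "cost F0 F x0 a \<beta> \<nu> \<mu> u = cost F0 F x0 a \<beta> \<nu> \<mu> v"
  by (simp add: cost_def trajectory_cong_AE[OF assms(3)] L2_norm_cong_AE[OF assms])

end

theory Submission
  imports Defs "HOL-Complex_Analysis.Great_Picard"
begin

text \<open>This is the direct method. The weight \<open>exp (2 * \<integral>m)\<close> turns the integral form of the control
  system into a contraction, which gives existence and uniqueness of trajectories and their stability.
  The primitives of an \<open>L\<^sup>2\<close>-bounded minimising sequence of controls are equicontinuous, so a
  subsequence converges uniformly, and its limit is the primitive of a control whose norm is at most
  the limit of the norms. Since the dynamics is affine in the control, uniform convergence of the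
  primitives suffices for the convergence of the trajectories, and then of the running costs by
  dominated convergence.\<close>

section \<open>Absolutely continuous functions\<close>

text \<open>No weak topology appears: uniform convergence of the primitives stands in for it. It is
  strong enough because replacing \<open>u\<close> by \<open>v\<close> along a fixed trajectory
  \<open>y\<close> perturbs the integral equation by the integral of
  \<open>F (y s) \<theta> *v (u s - v s)\<close>, and this is small once the primitive of
  \<open>u - v\<close> is small while its L1 norm stays bounded. It is weak enough to come from a
  mere norm bound. The price is that a uniform limit of primitives must be shown to be the primitive
  of a control, which takes a Hilbert space argument. The stability estimates depend on
  \<open>u\<close> only through its L2 norm, by way of
  \<open>norm u \<le> \<kappa> + (norm u)^2 / \<kappa>\<close> in place of Cauchy-Schwarz, so their
  constants are common to the whole minimising sequence. Since a trajectory is defined by its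
  derivative almost everywhere, access to the integral equation requires both halves of the
  fundamental theorem for absolutely continuous functions.\<close>

text \<open>The gauge follows the derivative off \<open>N\<close>; cells tagged in \<open>N\<close> are confined to an open set of
  small measure, on which \<open>f\<close> varies little by absolute continuity.\<close>

lemma fundamental_theorem_of_calculus_absolutely_continuous:
  fixes f :: "real \<Rightarrow> 'a::banach"
  assumes "a \<le> b" and ac: "absolutely_continuous_on_interval a b f" and N: "negligible N"
    and deriv: "\<And>x. x \<in> {a..b} - N \<Longrightarrow> (f has_vector_derivative f' x) (at x within {a..b})"
  shows "(f' has_integral (f b - f a)) {a..b}"
proof (cases "a = b")
  case True
  then show ?thesis by auto
next
  case False
  with \<open>a \<le> b\<close> have "a < b" by simp
  \<comment> \<open>Resetting \<open>f'\<close> to \<open>0\<close> on \<open>N\<close> leaves only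
    the increments of \<open>f\<close> as the contribution of the cells tagged in \<open>N\<close>,
    and does not change the integral.\<close>
  define g where "g x = (if x \<in> N then 0 else f' x)" for x
  have "(g has_integral (f b - f a)) {a..b}"
    unfolding has_integral_factor_content_real
  proof (intro allI impI)
    fix e :: real assume "e > 0"
    \<comment> \<open>One half pays for the cells tagged outside \<open>N\<close>, the other for
      those tagged in \<open>N\<close>.\<close>
    define e1 where "e1 = e / 2"
    have "e1 > 0" using \<open>e > 0\<close> by (simp add: e1_def)
    have "\<forall>x. \<exists>d>0. x \<in> {a..b} - N \<longrightarrow>
         (\<forall>y\<in>{a..b}. norm (y-x) < d \<longrightarrow> norm (f y - f x - (y-x) *\<^sub>R f' x) \<le> e1 * norm (y-x))"
      using deriv[unfolded has_vector_derivative_def has_derivative_within_alt] \<open>e1 > 0\<close>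
      by (metis zero_less_one)
    then obtain d where d: "\<And>x. 0 < d x"
      "\<And>x y. \<lbrakk>x \<in> {a..b} - N; y \<in> {a..b}; norm (y-x) < d x\<rbrakk>
                 \<Longrightarrow> norm (f y - f x - (y-x) *\<^sub>R f' x) \<le> e1 * norm (y-x)"
      by metis
    obtain \<delta> where "\<delta> > 0" and \<delta>: "\<And>(I :: nat set) l r. finite I \<Longrightarrow>
        (\<forall>i\<in>I. a \<le> l i \<and> l i \<le> r i \<and> r i \<le> b) \<Longrightarrow>
        disjoint_family_on (\<lambda>i. {l i<..<r i}) I \<Longrightarrow>
        (\<Sum>i\<in>I. r i - l i) < \<delta> \<Longrightarrow>
        (\<Sum>i\<in>I. norm (f (r i) - f (l i))) < e1 * (b - a)"
      using ac[unfolded absolutely_continuous_on_interval_def, rule_format, of "e1 * (b - a)"]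
        \<open>a < b\<close> \<open>e1 > 0\<close> by auto
    have "N \<in> sets lebesgue" using N by (simp add: negligible_imp_sets)
    then obtain U where U: "open U" "N \<subseteq> U" "emeasure lebesgue (U - N) < ennreal \<delta>"
      using sets_lebesgue_outer_open[of N \<delta>] \<open>\<delta> > 0\<close> by metis
    have N0: "emeasure lebesgue N = 0"
      using N by (simp add: negligible_iff_emeasure0 \<open>N \<in> sets lebesgue\<close>)
    have Ul: "U \<in> sets lebesgue" using U(1) by (auto intro!: sets_completionI_sets)
    have "emeasure lebesgue U \<le> emeasure lebesgue (U - N) + emeasure lebesgue N"
      using emeasure_subadditive[of "U - N" lebesgue N] Ul \<open>N \<in> sets lebesgue\<close> U(2)
      by (simp add: Un_absorb1 Un_absorb2)
    then have Um: "emeasure lebesgue U < ennreal \<delta>"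
      using U(3) N0 by simp
    have Ulm: "U \<in> lmeasurable"
      using Um Ul by (simp add: fmeasurable_def top.not_eq_extremum order_less_trans[OF _ ennreal_less_top])
    have mU: "measure lebesgue U < \<delta>"
      using Um Ulm \<open>\<delta> > 0\<close> by (simp add: emeasure_eq_measure2 ennreal_less_iff)
    define \<gamma> where "\<gamma> x = (if x \<in> N then U else ball x (d x))" for x
    have g\<gamma>: "gauge \<gamma>"
      using U(1,2) d(1) by (auto simp: gauge_def \<gamma>_def)
    have main: "norm ((\<Sum>(x, k)\<in>p. measure lborel k *\<^sub>R g x) - (f b - f a)) \<le> e * measure lborel {a..b}"
      if ptag: "p tagged_division_of {a..b}" and finep: "\<gamma> fine p" for p
    proof -
      define q where "q = {(x,K). (x,K) \<in> p \<and> x \<in> N}"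
      have qp: "q \<subseteq> p" by (auto simp: q_def)
      have finp: "finite p" using ptag by auto
      have ab: "b - a = (\<Sum>(x,K)\<in>p. Sup K - Inf K)" "f b - f a = (\<Sum>(x,K)\<in>p. f(Sup K) - f(Inf K))"
        using additive_tagged_division_1[where f= "\<lambda>x. x"] additive_tagged_division_1[where f= f]
              \<open>a \<le> b\<close> ptag by auto
      have K: "\<exists>u v. K = {u..v} \<and> u \<le> v \<and> x \<in> K \<and> K \<subseteq> {a..b}" if "(x,K) \<in> p" for x K
        using tagged_division_ofD(2,3,4)[OF ptag that] by (metis atLeastatMost_empty_iff box_real(2) empty_iff)
      have good: "norm (measure lborel K *\<^sub>R g x - (f (Sup K) - f (Inf K))) \<le> e1 * (Sup K - Inf K)"
        if "(x,K) \<in> p - q" for x K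
      proof -
        have xK: "(x,K) \<in> p" "x \<notin> N" using that by (auto simp: q_def)
        then obtain u v where uv: "K = {u..v}" "u \<le> v" "x \<in> K" "K \<subseteq> {a..b}" using K by blast
        have ball: "K \<subseteq> ball x (d x)"
          using fineD[OF finep xK(1)] xK(2) by (simp add: \<gamma>_def)
        have uK: "u \<in> K" "v \<in> K" using uv by auto
        have x: "x \<in> {a..b} - N" using uv xK by auto
        have 1: "norm (f u - f x - (u-x) *\<^sub>R f' x) \<le> e1 * (x - u)"
          using d(2)[OF x, of u] uK ball uv by (force simp: dist_real_def)
        have 2: "norm (f v - f x - (v-x) *\<^sub>R f' x) \<le> e1 * (v - x)"
          using d(2)[OF x, of v] uK ball uv by (force simp: dist_real_def)
        have "norm ((v - u) *\<^sub>R f' x - (f v - f u)) = norm (f u - f x - (u - x) *\<^sub>R f' x - (f v - f x - (v - x) *\<^sub>R f' x))"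
          by (auto simp: algebra_simps)
        also have "\<dots> \<le> e1 * (v - u)"
          using norm_triangle_ineq4[of "f u - f x - (u - x) *\<^sub>R f' x" "f v - f x - (v - x) *\<^sub>R f' x"] 1 2
          by (simp add: algebra_simps)
        finally show ?thesis using uv xK by (simp add: g_def)
      qed
      have bad: "(\<Sum>(x,K)\<in>q. norm (f (Sup K) - f (Inf K))) \<le> e1 * (b - a)"
      proof -
        have finq: "finite q" using finp qp finite_subset by blast
        \<comment> \<open>Absolute continuity is defined by families indexed by naturals, so the
          cells are enumerated.\<close>
        then obtain h :: "nat \<Rightarrow> real \<times> real set" and n where h: "bij_betw h {..<n} q"
          using ex_bij_betw_nat_finite[OF finq] by (metis atLeast0LessThan)
        have hq: "h i \<in> q" if "i < n" for i using h that by (auto simp: bij_betw_def)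
        have reind: "(\<Sum>(x,K)\<in>q. \<phi> (K::real set)) = (\<Sum>i<n. \<phi> (snd (h i)))" for \<phi> :: "_ \<Rightarrow> real"
          using sum.reindex_bij_betw[OF h, of "\<lambda>z. \<phi> (snd z)"] by (simp add: split_beta)
        have qtag: "q tagged_partial_division_of {a..b}"
        proof (rule tagged_partial_division_subset[OF _ qp])
          show "p tagged_partial_division_of {a..b}"
            using ptag by (simp only: tagged_division_of_def)
        qed
        have bnds: "a \<le> Inf (snd (h i)) \<and> Inf (snd (h i)) \<le> Sup (snd (h i)) \<and> Sup (snd (h i)) \<le> b"
            "{Inf (snd (h i))<..<Sup (snd (h i))} \<subseteq> interior (snd (h i))"
            "measure lborel (snd (h i)) = Sup (snd (h i)) - Inf (snd (h i))"
          if "i < n" for i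
        proof -
          have "(fst (h i), snd (h i)) \<in> p" using hq[OF that] qp by auto
          from K[OF this] show "a \<le> Inf (snd (h i)) \<and> Inf (snd (h i)) \<le> Sup (snd (h i)) \<and> Sup (snd (h i)) \<le> b"
            "{Inf (snd (h i))<..<Sup (snd (h i))} \<subseteq> interior (snd (h i))"
            "measure lborel (snd (h i)) = Sup (snd (h i)) - Inf (snd (h i))" by auto
        qed
        have disj: "disjoint_family_on (\<lambda>i. {Inf (snd (h i))<..<Sup (snd (h i))}) {..<n}"
          unfolding disjoint_family_on_def
        proof (intro ballI impI)
          fix i j assume ij: "i \<in> {..<n}" "j \<in> {..<n}" "i \<noteq> j"
          then have "h i \<noteq> h j" using h by (auto simp: bij_betw_def inj_on_def)
          moreover have "(fst (h i), snd (h i)) \<in> p" "(fst (h j), snd (h j)) \<in> p"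
            using hq ij qp by auto
          ultimately have "interior (snd (h i)) \<inter> interior (snd (h j)) = {}"
            using tagged_division_ofD(5)[OF ptag] by (metis prod.collapse)
          then show "{Inf (snd (h i))<..<Sup (snd (h i))} \<inter> {Inf (snd (h j))<..<Sup (snd (h j))} = {}"
            using bnds(2) ij by fastforce
        qed
        have div: "snd ` q division_of \<Union>(snd ` q)"
          using qtag partial_division_of_tagged_division by blast
        \<comment> \<open>Two tags can share a cell only if its interior is empty; its measure is
          then 0, so summing over tagged pairs is the same as summing over cells.\<close>
        have "(\<Sum>(x,K)\<in>q. measure lborel K) = (\<Sum>K\<in>snd ` q. measure lborel K)"
        proof -
          have qt: "q tagged_division_of \<Union>(snd ` q)"
            using qtag tagged_partial_division_of_Union_self by blast
          show ?thesis
            by (rule sum.over_tagged_division_lemma[OF qt]) (simp add: box_eq_empty content_eq_0_interior interior_cbox)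
        qed
        also have "\<dots> = measure lebesgue (\<Union>(snd ` q))"
        proof -
          have "K \<in> sets lborel" if Kq: "K \<in> snd ` q" for K
          proof -
            obtain x where "(x, K) \<in> p" using Kq qp by auto
            from K[OF this] show ?thesis by auto
          qed
          then show ?thesis
            using content_division[OF div] by simp
        qed
        also have "\<dots> \<le> measure lebesgue U"
        proof (rule measure_mono_fmeasurable)
          show "\<Union>(snd ` q) \<subseteq> U"
          proof clarsimp
            fix z x K assume "z \<in> K" "(x, K) \<in> q"
            then show "z \<in> U"
              using fineD[OF finep, of x K] by (auto simp: q_def \<gamma>_def)
          qed
          show "\<Union>(snd ` q) \<in> sets lebesgue"
            using div lmeasurable_division by blast
        qed (rule Ulm)
        finally have "(\<Sum>(x,K)\<in>q. measure lborel K) < \<delta>" using mU by simp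
        then have "(\<Sum>i<n. measure lborel (snd (h i))) < \<delta>" by (simp add: reind)
        then have "(\<Sum>i<n. Sup (snd (h i)) - Inf (snd (h i))) < \<delta>" using bnds(3) by simp
        from \<delta>[OF _ _ disj this] bnds(1)
        show ?thesis by (simp add: reind[of "\<lambda>K. norm (f (Sup K) - f (Inf K))"])
      qed
      have "(\<Sum>(x, k)\<in>p. measure lborel k *\<^sub>R g x) - (f b - f a)
          = (\<Sum>(x,K)\<in>p. measure lborel K *\<^sub>R g x - (f (Sup K) - f (Inf K)))"
        by (simp add: ab(2) split_beta sum_subtractf)
      also have "norm \<dots> \<le> (\<Sum>(x,K)\<in>p. norm (measure lborel K *\<^sub>R g x - (f (Sup K) - f (Inf K))))"
        by (rule order_trans[OF norm_sum]) (simp add: split_beta)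
      also have "\<dots> = (\<Sum>(x,K)\<in>p - q. norm (measure lborel K *\<^sub>R g x - (f (Sup K) - f (Inf K))))
          + (\<Sum>(x,K)\<in>q. norm (measure lborel K *\<^sub>R g x - (f (Sup K) - f (Inf K))))"
        using sum.subset_diff[OF qp finp] by blast
      also have "(\<Sum>(x,K)\<in>q. norm (measure lborel K *\<^sub>R g x - (f (Sup K) - f (Inf K))))
          = (\<Sum>(x,K)\<in>q. norm (f (Sup K) - f (Inf K)))"
        by (rule sum.cong) (auto simp: q_def g_def norm_minus_commute)
      also have "(\<Sum>(x,K)\<in>p - q. norm (measure lborel K *\<^sub>R g x - (f (Sup K) - f (Inf K))))
          \<le> (\<Sum>(x,K)\<in>p - q. e1 * (Sup K - Inf K))"
        using good by (intro sum_mono) auto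
      also have "\<dots> \<le> (\<Sum>(x,K)\<in>p. e1 * (Sup K - Inf K))"
        using finp K \<open>e1 > 0\<close> by (intro sum_mono2) (auto, fastforce)
      also have "\<dots> = e1 * (b - a)"
        by (simp add: ab(1) sum_distrib_left split_beta)
      finally show ?thesis
        using bad \<open>a < b\<close> by (simp add: e1_def)
    qed
    show "\<exists>d. gauge d \<and> (\<forall>p. p tagged_division_of {a..b} \<and> d fine p \<longrightarrow>
      norm ((\<Sum>(x, k)\<in>p. measure lborel k *\<^sub>R g x) - (f b - f a)) \<le> e * measure lborel {a..b})"
    proof (intro exI[of _ \<gamma>] conjI allI impI)
      fix p assume "p tagged_division_of {a..b} \<and> \<gamma> fine p"
      then show "norm ((\<Sum>(x, k)\<in>p. measure lborel k *\<^sub>R g x) - (f b - f a)) \<le> e * measure lborel {a..b}"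
        by (elim conjE) (rule main)
    qed (rule g\<gamma>)
  qed
  then show ?thesis
    by (rule has_integral_spike[OF N, rotated]) (auto simp: g_def)
qed

text \<open>Cut \<open>norm f\<close> at a height \<open>n\<close>. By dominated convergence the
  part above the cut has integral below \<open>\<epsilon> / 2\<close> over the whole interval, while
  the part below it contributes at most \<open>n\<close> times the total length of the
  subintervals.\<close>

lemma absolutely_continuous_indefinite_integral:
  fixes f :: "real \<Rightarrow> 'a::euclidean_space"
  assumes f: "f absolutely_integrable_on {a..b}"
  shows "absolutely_continuous_on_interval a b (\<lambda>t. integral {a..t} f)"
  unfolding absolutely_continuous_on_interval_def
proof (intro allI impI)
  fix \<epsilon> :: real assume "\<epsilon> > 0"
  define h where "h n x = min (norm (f x)) (real n)" for n x
  have nf: "(\<lambda>x. norm (f x)) integrable_on {a..b}" and fi: "f integrable_on {a..b}"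
    using f by (auto simp: absolutely_integrable_on_def)
  have hi: "h n integrable_on {a..b}" for n
  proof -
    have "(\<lambda>x. norm (f x)) absolutely_integrable_on {a..b}"
      using nf by (simp add: nonnegative_absolutely_integrable_1)
    moreover have "(\<lambda>x. real n) absolutely_integrable_on {a..b}"
      by (simp add: nonnegative_absolutely_integrable_1)
    ultimately have "(\<lambda>x. min (norm (f x)) (real n)) absolutely_integrable_on {a..b}"
      by (rule absolutely_integrable_min_1)
    then show ?thesis
      unfolding h_def[abs_def] by (rule set_lebesgue_integral_eq_integral(1))
  qed
  have "(\<lambda>n. integral {a..b} (h n)) \<longlonglongrightarrow> integral {a..b} (\<lambda>x. norm (f x))"
  proof (rule dominated_convergence(2)[OF hi nf])
    show "norm (h n x) \<le> norm (f x)" for n x by (auto simp: h_def)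
    show "(\<lambda>n. h n x) \<longlonglongrightarrow> norm (f x)" for x
    proof (rule tendsto_eventually)
      show "\<forall>\<^sub>F n in sequentially. h n x = norm (f x)"
        using eventually_ge_at_top[of "nat \<lceil>norm (f x)\<rceil>"]
        by eventually_elim (auto simp: h_def min_def)
    qed
  qed
  then obtain n where n: "dist (integral {a..b} (h n)) (integral {a..b} (\<lambda>x. norm (f x))) < \<epsilon> / 2"
    using \<open>\<epsilon> > 0\<close> unfolding lim_sequentially by (meson half_gt_zero order_refl)
  define g where "g x = norm (f x) - h n x" for x
  have gi: "g integrable_on {a..b}" unfolding g_def[abs_def] by (intro integrable_diff nf hi)
  have g0: "g x \<ge> 0" for x by (auto simp: g_def h_def)
  have "integral {a..b} g = integral {a..b} (\<lambda>x. norm (f x)) - integral {a..b} (h n)"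
    unfolding g_def[abs_def] by (intro integral_diff nf hi)
  then have gint: "integral {a..b} g < \<epsilon> / 2"
    using n unfolding dist_real_def by linarith
  show "\<exists>\<delta>>0. \<forall>(I::nat set) l r. finite I \<longrightarrow> (\<forall>i\<in>I. a \<le> l i \<and> l i \<le> r i \<and> r i \<le> b) \<longrightarrow>
      disjoint_family_on (\<lambda>i. {l i<..<r i}) I \<longrightarrow> (\<Sum>i\<in>I. r i - l i) < \<delta> \<longrightarrow>
      (\<Sum>i\<in>I. norm (integral {a..r i} f - integral {a..l i} f)) < \<epsilon>"
  \<comment> \<open>This length makes the part below the cut at most \<open>\<epsilon> / 2\<close>;
    \<open>n + 1\<close> instead of \<open>n\<close> covers \<open>n = 0\<close>.\<close>
  proof (intro exI[of _ "\<epsilon> / (2 * (real n + 1))"] conjI allI impI)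
    show "0 < \<epsilon> / (2 * (real n + 1))" using \<open>\<epsilon> > 0\<close> by simp
    fix I :: "nat set" and l r
    assume I: "finite I" "\<forall>i\<in>I. a \<le> l i \<and> l i \<le> r i \<and> r i \<le> b"
      "disjoint_family_on (\<lambda>i. {l i<..<r i}) I" "(\<Sum>i\<in>I. r i - l i) < \<epsilon> / (2 * (real n + 1))"
    have gsub: "g integrable_on {l i..r i}" if "i \<in> I" for i
      using integrable_on_subinterval[OF gi] I(2) that by auto
    have 1: "norm (integral {a..r i} f - integral {a..l i} f) \<le> integral {l i..r i} g + real n * (r i - l i)"
      if "i \<in> I" for i
    proof -
      have fs: "f integrable_on {a..r i}" "f integrable_on {l i..r i}"
        using integrable_on_subinterval[OF fi] I(2) that by auto
      have "integral {a..r i} f - integral {a..l i} f = integral {l i..r i} f"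
        using Henstock_Kurzweil_Integration.integral_combine[of a "l i" "r i" f] fs I(2) that
        by (auto simp: algebra_simps)
      also have "norm \<dots> \<le> integral {l i..r i} (\<lambda>x. g x + real n)"
      proof (rule integral_norm_bound_integral[OF fs(2)])
        show "(\<lambda>x. g x + real n) integrable_on {l i..r i}"
          by (intro integrable_add gsub that integrable_const_ivl)
      qed (auto simp: g_def h_def)
      also have "\<dots> = integral {l i..r i} g + real n * (r i - l i)"
        using I(2) that by (subst integral_add) (auto intro!: gsub)
      finally show ?thesis .
    qed
    have "((\<lambda>x. g x) has_integral (\<Sum>i\<in>I. integral {l i..r i} g)) (\<Union>i\<in>I. {l i<..<r i})"
    proof (rule has_integral_UN[OF I(1)])
      show "(g has_integral integral {l i..r i} g) {l i<..<r i}" if "i \<in> I" for i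
        using gsub[OF that] by (simp add: has_integral_Icc_iff_Ioo[symmetric] integrable_integral)
      show "pairwise (\<lambda>i i'. negligible ({l i<..<r i} \<inter> {l i'<..<r i'})) I"
        using I(3) by (auto simp: pairwise_def disjoint_family_on_def)
    qed
    then have "(\<Sum>i\<in>I. integral {l i..r i} g) = integral (\<Union>i\<in>I. {l i<..<r i}) g"
      "g integrable_on (\<Union>i\<in>I. {l i<..<r i})"
      by (auto simp: integral_unique)
    moreover have "integral (\<Union>i\<in>I. {l i<..<r i}) g \<le> integral {a..b} g"
      using I(2) g0 by (intro integral_subset_le calculation gi) force+
    ultimately have "(\<Sum>i\<in>I. integral {l i..r i} g) < \<epsilon> / 2" using gint by simp
    moreover have "real n * (\<Sum>i\<in>I. r i - l i) \<le> \<epsilon> / 2"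
    proof -
      have "real n * (\<Sum>i\<in>I. r i - l i) \<le> (real n + 1) * (\<Sum>i\<in>I. r i - l i)"
        using I(2) by (intro mult_right_mono sum_nonneg) auto
      also have "\<dots> \<le> (real n + 1) * (\<epsilon> / (2 * (real n + 1)))"
        using I(4) by (intro mult_left_mono) auto
      also have "\<dots> = \<epsilon> / 2" by (simp add: field_simps)
      finally show ?thesis .
    qed
    moreover have "(\<Sum>i\<in>I. norm (integral {a..r i} f - integral {a..l i} f))
        \<le> (\<Sum>i\<in>I. integral {l i..r i} g) + real n * (\<Sum>i\<in>I. r i - l i)"
      using sum_mono[OF 1] by (simp add: sum.distrib sum_distrib_left)
    ultimately show "(\<Sum>i\<in>I. norm (integral {a..r i} f - integral {a..l i} f)) < \<epsilon>" by linarith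
  qed
qed

text \<open>Lebesgue's differentiation theorem. \<open>integrable_ccontinuous_explicit\<close>
  averages over boxes that start at the point, which yields the right-hand derivative; applied to
  the reflected function at \<open>- x\<close> it yields the left-hand one.\<close>

lemma has_vector_derivative_indefinite_integral_AE:
  fixes f :: "real \<Rightarrow> 'a::euclidean_space"
  assumes f: "f integrable_on {a..b}"
  obtains N where "negligible N"
    "\<And>x. x \<in> {a..b} - N \<Longrightarrow> ((\<lambda>t. integral {a..t} f) has_vector_derivative f x) (at x within {a..b})"
proof -
  \<comment> \<open>Extension by \<open>0\<close> gives integrability on every box, including those
    that leave \<open>{a..b}\<close>.\<close>
  define g where "g x = (if x \<in> {a..b} then f x else 0)" for x
  have g: "g integrable_on cbox c d" for c d
  proof -
    have "g integrable_on UNIV"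
      unfolding g_def[abs_def] using f integrable_restrict_UNIV[of "{a..b}" f] by (simp del: atLeastAtMost_iff)
    then show ?thesis by (rule integrable_on_subcbox) auto
  qed
  have gm: "(\<lambda>x. g (- x)) integrable_on cbox c d" for c d
    using g[of "-d" "-c"] Henstock_Kurzweil_Integration.integrable_reflect_real[of g "-c" "-d"] by (auto simp: box_real)
  obtain N1 where N1: "negligible N1"
    "\<And>x e. \<lbrakk>x \<notin> N1; 0 < e\<rbrakk> \<Longrightarrow> \<exists>d>0. \<forall>h. 0 < h \<and> h < d \<longrightarrow>
       norm (integral (cbox x (x + h *\<^sub>R One)) g /\<^sub>R h ^ DIM(real) - g x) < e"
    using integrable_ccontinuous_explicit[of g] g by metis
  obtain N2 where N2: "negligible N2"
    "\<And>x e. \<lbrakk>x \<notin> N2; 0 < e\<rbrakk> \<Longrightarrow> \<exists>d>0. \<forall>h. 0 < h \<and> h < d \<longrightarrow>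
       norm (integral (cbox x (x + h *\<^sub>R One)) (\<lambda>x. g (- x)) /\<^sub>R h ^ DIM(real) - g (- x)) < e"
    using integrable_ccontinuous_explicit[of "\<lambda>x. g (- x)"] gm by metis
  define N where "N = N1 \<union> uminus ` N2"
  show ?thesis
  proof
    have "negligible (uminus ` N2)"
      by (rule negligible_differentiable_image_negligible) (auto simp: N2 differentiable_on_def)
    then show "negligible N" using N1 by (simp add: N_def)
  next
    fix x assume x: "x \<in> {a..b} - N"
    then have xN: "x \<notin> N1" "- x \<notin> N2" by (auto simp: N_def image_iff)
    have diff: "integral {a..t} f - integral {a..s} f = integral {s..t} g" if "a \<le> s" "s \<le> t" "t \<le> b" for s t
    proof -
      have fs: "f integrable_on {a..t}"
        using integrable_on_subinterval[OF f] that by auto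
      have "integral {s..t} g = integral {s..t} f"
        using that by (intro integral_cong) (auto simp: g_def)
      then show ?thesis
        using Henstock_Kurzweil_Integration.integral_combine[of a s t f] fs that
        by (auto simp: algebra_simps)
    qed
    show "((\<lambda>t. integral {a..t} f) has_vector_derivative f x) (at x within {a..b})"
      unfolding has_vector_derivative_def has_derivative_within_alt
    proof (intro conjI allI impI)
      show "bounded_linear (\<lambda>h. h *\<^sub>R f x)" by (rule bounded_linear_scaleR_left)
      fix e :: real assume "e > 0"
      obtain d1 where d1: "d1 > 0" "\<And>h. 0 < h \<Longrightarrow> h < d1 \<Longrightarrow> norm (integral {x..x+h} g /\<^sub>R h - g x) < e"
        using N1(2)[OF xN(1) \<open>e > 0\<close>] by (auto simp: box_real)
      obtain d2 where d2: "d2 > 0"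
        "\<And>h. 0 < h \<Longrightarrow> h < d2 \<Longrightarrow> norm (integral {-x..-x+h} (\<lambda>x. g (- x)) /\<^sub>R h - g x) < e"
        using N2(2)[OF xN(2) \<open>e > 0\<close>] by (auto simp: box_real)
      have scale: "norm (v - h *\<^sub>R w) \<le> e * h" if "norm (v /\<^sub>R h - w) < e" "h > 0" for v w :: 'a and h
      proof -
        have "v - h *\<^sub>R w = h *\<^sub>R (v /\<^sub>R h - w)" using that by (simp add: algebra_simps)
        then have "norm (v - h *\<^sub>R w) = h * norm (v /\<^sub>R h - w)" using that by simp
        also have "\<dots> \<le> h * e" using that by (intro mult_left_mono) auto
        finally show ?thesis by (simp add: mult.commute)
      qed
      have gx: "g x = f x" using x by (auto simp: g_def)
      show "\<exists>d>0. \<forall>y\<in>{a..b}. norm (y - x) < d \<longrightarrow>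
          norm (integral {a..y} f - integral {a..x} f - (y - x) *\<^sub>R f x) \<le> e * norm (y - x)"
      proof (intro exI[of _ "min d1 d2"] conjI ballI impI)
        show "0 < min d1 d2" using d1 d2 by simp
        fix y assume y: "y \<in> {a..b}" "norm (y - x) < min d1 d2"
        consider "y = x" | "y > x" | "y < x" by linarith
        then show "norm (integral {a..y} f - integral {a..x} f - (y - x) *\<^sub>R f x) \<le> e * norm (y - x)"
        proof cases
          case 1
          then show ?thesis by simp
        next
          case 2
          have "norm (integral {x..y} g - (y - x) *\<^sub>R g x) \<le> e * (y - x)"
            using d1(2)[of "y - x"] 2 y by (intro scale) auto
          then show ?thesis using 2 x y gx by (subst diff) auto
        next
          case 3
          have "integral {-x..-y} (\<lambda>x. g (- x)) = integral {y..x} g"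
            by (rule Henstock_Kurzweil_Integration.integral_reflect_real)
          then have "norm (integral {y..x} g - (x - y) *\<^sub>R g x) \<le> e * (x - y)"
            using d2(2)[of "x - y"] 3 y by (intro scale) auto
          moreover have "integral {a..y} f - integral {a..x} f - (y - x) *\<^sub>R f x
              = - (integral {y..x} g - (x - y) *\<^sub>R g x)"
            using diff[of y x] 3 x y gx by (simp add: algebra_simps)
          ultimately show ?thesis using 3 by (simp add: norm_minus_commute)
        qed
      qed
    qed
  qed
qed

section \<open>Integral inequalities and equations\<close>

lemma absolutely_continuous_on_interval_imp_continuous_on:
  assumes "absolutely_continuous_on_interval a b f"
  shows "continuous_on {a..b} f"
  unfolding continuous_on_iff
proof (intro ballI allI impI)
  fix x e :: real assume x: "x \<in> {a..b}" and "e > 0"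
  then obtain \<delta> where "\<delta> > 0" and \<delta>: "\<And>(I :: nat set) l r. finite I \<Longrightarrow>
        (\<forall>i\<in>I. a \<le> l i \<and> l i \<le> r i \<and> r i \<le> b) \<Longrightarrow>
        disjoint_family_on (\<lambda>i. {l i<..<r i}) I \<Longrightarrow>
        (\<Sum>i\<in>I. r i - l i) < \<delta> \<Longrightarrow>
        (\<Sum>i\<in>I. norm (f (r i) - f (l i))) < e"
    using assms[unfolded absolutely_continuous_on_interval_def, rule_format, of e] by auto
  have one: "norm (f r - f l) < e" if "a \<le> l" "l \<le> r" "r \<le> b" "r - l < \<delta>" for l r
    using \<delta>[of "{0}" "\<lambda>_. l" "\<lambda>_. r"] that by (simp add: disjoint_family_on_def)
  have "dist (f y) (f x) < e" if "y \<in> {a..b}" "dist y x < \<delta>" for y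
  proof (cases "y \<le> x")
    case True
    then show ?thesis using one[of y x] that x by (auto simp: dist_norm norm_minus_commute)
  next
    case False
    then show ?thesis using one[of x y] that x by (auto simp: dist_norm norm_minus_commute)
  qed
  then show "\<exists>d>0. \<forall>x'\<in>{a..b}. dist x' x < d \<longrightarrow> dist (f x') (f x) < e"
    using \<open>\<delta> > 0\<close> by blast
qed

lemma absolutely_continuous_on_interval_subinterval:
  assumes "absolutely_continuous_on_interval a b f" "a \<le> c" "d \<le> b"
  shows "absolutely_continuous_on_interval c d f"
  unfolding absolutely_continuous_on_interval_def
proof (intro allI impI)
  fix e :: real assume "e > 0"
  then obtain \<delta> where "\<delta> > 0" and \<delta>: "\<And>(I :: nat set) l r. finite I \<Longrightarrow>
        (\<forall>i\<in>I. a \<le> l i \<and> l i \<le> r i \<and> r i \<le> b) \<Longrightarrow>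
        disjoint_family_on (\<lambda>i. {l i<..<r i}) I \<Longrightarrow>
        (\<Sum>i\<in>I. r i - l i) < \<delta> \<Longrightarrow>
        (\<Sum>i\<in>I. norm (f (r i) - f (l i))) < e"
    using assms(1)[unfolded absolutely_continuous_on_interval_def, rule_format, of e] by auto
  show "\<exists>\<delta>>0. \<forall>(I::nat set) l r. finite I \<longrightarrow>
          (\<forall>i\<in>I. c \<le> l i \<and> l i \<le> r i \<and> r i \<le> d) \<longrightarrow>
          disjoint_family_on (\<lambda>i. {l i<..<r i}) I \<longrightarrow>
          (\<Sum>i\<in>I. r i - l i) < \<delta> \<longrightarrow> (\<Sum>i\<in>I. norm (f (r i) - f (l i))) < e"
  proof (intro exI[of _ \<delta>] conjI allI impI)
    fix I :: "nat set" and l r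
    assume "finite I" "\<forall>i\<in>I. c \<le> l i \<and> l i \<le> r i \<and> r i \<le> d"
      "disjoint_family_on (\<lambda>i. {l i<..<r i}) I" "(\<Sum>i\<in>I. r i - l i) < \<delta>"
    then show "(\<Sum>i\<in>I. norm (f (r i) - f (l i))) < e"
      using assms(2,3) by (intro \<delta>) force+
  qed (rule \<open>\<delta> > 0\<close>)
qed

text \<open>Used with a Lipschitz constant of \<open>exp\<close> on a bounded range, and with
  \<open>C = 1\<close> for functions that differ by a constant.\<close>

lemma absolutely_continuous_on_interval_dominated:
  assumes "absolutely_continuous_on_interval a b f" "C \<ge> 0"
    and le: "\<And>s t. s \<in> {a..b} \<Longrightarrow> t \<in> {a..b} \<Longrightarrow> norm (g s - g t) \<le> C * norm (f s - f t)"
  shows "absolutely_continuous_on_interval a b g"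
  unfolding absolutely_continuous_on_interval_def
proof (intro allI impI)
  fix e :: real assume "e > 0"
  \<comment> \<open>\<open>C + 1\<close> rather than \<open>C\<close> covers \<open>C = 0\<close>
    and makes the final inequality strict.\<close>
  then have "e / (C + 1) > 0" using \<open>C \<ge> 0\<close> by simp
  then obtain \<delta> where "\<delta> > 0" and \<delta>: "\<And>(I :: nat set) l r. finite I \<Longrightarrow>
        (\<forall>i\<in>I. a \<le> l i \<and> l i \<le> r i \<and> r i \<le> b) \<Longrightarrow>
        disjoint_family_on (\<lambda>i. {l i<..<r i}) I \<Longrightarrow>
        (\<Sum>i\<in>I. r i - l i) < \<delta> \<Longrightarrow>
        (\<Sum>i\<in>I. norm (f (r i) - f (l i))) < e / (C + 1)"
    using assms(1)[unfolded absolutely_continuous_on_interval_def, rule_format, of "e / (C + 1)"] by auto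
  show "\<exists>\<delta>>0. \<forall>(I::nat set) l r. finite I \<longrightarrow>
          (\<forall>i\<in>I. a \<le> l i \<and> l i \<le> r i \<and> r i \<le> b) \<longrightarrow>
          disjoint_family_on (\<lambda>i. {l i<..<r i}) I \<longrightarrow>
          (\<Sum>i\<in>I. r i - l i) < \<delta> \<longrightarrow> (\<Sum>i\<in>I. norm (g (r i) - g (l i))) < e"
  proof (intro exI[of _ \<delta>] conjI allI impI)
    fix I :: "nat set" and l r
    assume I: "finite I" "\<forall>i\<in>I. a \<le> l i \<and> l i \<le> r i \<and> r i \<le> b"
      "disjoint_family_on (\<lambda>i. {l i<..<r i}) I" "(\<Sum>i\<in>I. r i - l i) < \<delta>"
    have "(\<Sum>i\<in>I. norm (g (r i) - g (l i))) \<le> (\<Sum>i\<in>I. C * norm (f (r i) - f (l i)))"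
      using I(2) by (intro sum_mono le) force+
    also have "\<dots> = C * (\<Sum>i\<in>I. norm (f (r i) - f (l i)))"
      by (simp add: sum_distrib_left)
    also have "\<dots> \<le> C * (e / (C + 1))"
      using \<delta>[OF I] \<open>C \<ge> 0\<close> by (intro mult_left_mono) auto
    also have "\<dots> < e" using \<open>C \<ge> 0\<close> \<open>e > 0\<close> by (simp add: field_simps)
    finally show "(\<Sum>i\<in>I. norm (g (r i) - g (l i))) < e" .
  qed (rule \<open>\<delta> > 0\<close>)
qed

text \<open>Since \<open>m\<close> is merely integrable, the chain rule holds only almost
  everywhere. The fundamental theorem still applies: the integral of \<open>m\<close> stays in a
  bounded range, where \<open>exp\<close> is Lipschitz, so the composition is absolutely
  continuous.\<close>

lemma has_integral_mult_exp_integral: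
  fixes m :: "real \<Rightarrow> real"
  assumes m: "m integrable_on {a..b}" and m0: "\<And>s. s \<in> {a..b} \<Longrightarrow> 0 \<le> m s" and t: "t \<in> {a..b}"
  shows "((\<lambda>s. m s * exp (integral {a..s} m)) has_integral (exp (integral {a..t} m) - 1)) {a..t}"
proof -
  define M where "M t = integral {a..t} m" for t
  have ma: "m absolutely_integrable_on {a..b}"
    using m m0 by (intro nonnegative_absolutely_integrable_1) auto
  have M_bound: "M s \<in> {0..M b}" if "s \<in> {a..b}" for s
  proof -
    have ms: "m integrable_on {a..s}" using integrable_on_subinterval[OF m] that by auto
    show ?thesis
      using integral_nonneg[OF ms] integral_subset_le[OF _ ms m] m0 that by (auto simp: M_def)
  qed
  have "absolutely_continuous_on_interval a b (\<lambda>s. exp (M s))"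
  proof (rule absolutely_continuous_on_interval_dominated[where f = M and C = "exp (M b)"])
    show "absolutely_continuous_on_interval a b M"
      unfolding M_def[abs_def] by (rule absolutely_continuous_indefinite_integral[OF ma])
    show "norm (exp (M x) - exp (M y)) \<le> exp (M b) * norm (M x - M y)" if "x \<in> {a..b}" "y \<in> {a..b}" for x y
      using M_bound[OF that(1)] M_bound[OF that(2)]
      by (intro field_differentiable_bound[of "{0..M b}" exp exp])
         (auto intro!: DERIV_exp has_field_derivative_at_within)
  qed auto
  then have ac: "absolutely_continuous_on_interval a t (\<lambda>s. exp (M s))"
    using t by (auto intro: absolutely_continuous_on_interval_subinterval)
  obtain N where N: "negligible N"
    "\<And>x. x \<in> {a..b} - N \<Longrightarrow> (M has_vector_derivative m x) (at x within {a..b})"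
    using has_vector_derivative_indefinite_integral_AE[OF m] unfolding M_def[abs_def] by metis
  have "((\<lambda>s. m s * exp (M s)) has_integral exp (M t) - exp (M a)) {a..t}"
  proof (rule fundamental_theorem_of_calculus_absolutely_continuous[OF _ ac N(1)])
    fix x assume x: "x \<in> {a..t} - N"
    then have "(M has_vector_derivative m x) (at x within {a..t})"
      using N(2)[of x] t by (auto intro: has_vector_derivative_within_subset)
    then have "(M has_field_derivative m x) (at x within {a..t})"
      by (simp add: has_real_derivative_iff_has_vector_derivative)
    then have "((\<lambda>s. exp (M s)) has_field_derivative exp (M x) * m x) (at x within {a..t})"
      by (intro DERIV_chain2[of exp] DERIV_exp)
    then show "((\<lambda>s. exp (M s)) has_vector_derivative m x * exp (M x)) (at x within {a..t})"
      by (simp add: has_real_derivative_iff_has_vector_derivative mult.commute)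
  qed (use t in auto)
  then show ?thesis by (simp add: M_def)
qed

lemma absolutely_integrable_continuous_bilinear:
  fixes G :: "real \<Rightarrow> 'a::euclidean_space" and f :: "real \<Rightarrow> 'b::euclidean_space"
    and h :: "'a \<Rightarrow> 'b \<Rightarrow> 'c::euclidean_space"
  assumes "bilinear h" "continuous_on {a..b} G" "f absolutely_integrable_on {a..b}"
  shows "(\<lambda>s. h (G s) (f s)) absolutely_integrable_on {a..b}"
proof (rule absolutely_integrable_bounded_measurable_product[OF assms(1) _ _ _ assms(3)])
  show "G \<in> borel_measurable (lebesgue_on {a..b})"
    by (rule continuous_imp_measurable_on_sets_lebesgue[OF assms(2)]) simp
  show "bounded (G ` {a..b})"
    by (intro compact_imp_bounded compact_continuous_image assms compact_Icc)
qed simp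

lemma bilinear_times_real: "bilinear ((*) :: real \<Rightarrow> real \<Rightarrow> real)"
  by (simp add: bilinear_conv_bounded_bilinear bounded_bilinear_mult)

lemma integrable_mult_continuous:
  fixes m v :: "real \<Rightarrow> real"
  assumes "m integrable_on {a..b}" "\<And>s. s \<in> {a..b} \<Longrightarrow> 0 \<le> m s" "continuous_on {a..b} v"
  shows "(\<lambda>s. m s * v s) integrable_on {a..b}"
proof -
  have "m absolutely_integrable_on {a..b}"
    using assms by (intro nonnegative_absolutely_integrable_1) auto
  from absolutely_integrable_continuous_bilinear[OF bilinear_times_real assms(3) this]
  show ?thesis by (simp add: mult.commute set_lebesgue_integral_eq_integral(1))
qed

lemma integrable_mult_norm_diff:
  fixes m :: "real \<Rightarrow> real" and y z :: "real \<Rightarrow> 'a::euclidean_space"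
  assumes m: "m integrable_on {a..b}" and m0: "\<And>s. s \<in> {a..b} \<Longrightarrow> 0 \<le> m s"
    and yz: "continuous_on {a..b} y" "continuous_on {a..b} z" and t: "t \<in> {a..b}"
  shows "(\<lambda>s. m s * norm (y s - z s)) integrable_on {a..t}"
proof (rule integrable_on_subinterval)
  show "(\<lambda>s. m s * norm (y s - z s)) integrable_on {a..b}"
    by (intro integrable_mult_continuous[OF m m0] continuous_intros yz)
  show "{a..t} \<subseteq> {a..b}" using t by auto
qed

text \<open>In the norm weighted by \<open>exp (2 * \<integral>m)\<close>, integration against \<open>m\<close> has norm at most \<open>1/2\<close>.\<close>

lemma integral_mult_exp_le:
  fixes m v :: "real \<Rightarrow> real"
  assumes m: "m integrable_on {a..b}" and m0: "\<And>s. s \<in> {a..b} \<Longrightarrow> 0 \<le> m s"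
    and v: "continuous_on {a..b} v" and K: "K \<ge> 0"
    and vK: "\<And>s. s \<in> {a..b} \<Longrightarrow> v s \<le> K * exp (2 * integral {a..s} m)" and t: "t \<in> {a..b}"
  shows "integral {a..t} (\<lambda>s. m s * v s) \<le> K / 2 * exp (2 * integral {a..t} m)"
proof -
  have m2: "integral {a..s} (\<lambda>s. 2 * m s) = 2 * integral {a..s} m" for s by simp
  have "((\<lambda>s. 2 * m s * exp (2 * integral {a..s} m)) has_integral (exp (2 * integral {a..t} m) - 1)) {a..t}"
    using has_integral_mult_exp_integral[of "\<lambda>s. 2 * m s" a b t] m m0 t
    by (simp add: integrable_on_cmult_left)
  from has_integral_mult_right[OF this, of "K / 2"]
  have hi: "((\<lambda>s. m s * (K * exp (2 * integral {a..s} m))) has_integral (K / 2 * (exp (2 * integral {a..t} m) - 1))) {a..t}"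
    by (simp add: mult_ac)
  have "(\<lambda>s. m s * v s) integrable_on {a..t}"
    using integrable_on_subinterval[OF integrable_mult_continuous[OF m m0 v], of a t] t by auto
  then have "integral {a..t} (\<lambda>s. m s * v s) \<le> integral {a..t} (\<lambda>s. m s * (K * exp (2 * integral {a..s} m)))"
    using hi t m0 vK by (intro integral_le) (auto intro!: mult_left_mono)
  also have "\<dots> = K / 2 * (exp (2 * integral {a..t} m) - 1)" using hi by (rule integral_unique)
  also have "\<dots> \<le> K / 2 * exp (2 * integral {a..t} m)" using K by (intro mult_left_mono) auto
  finally show ?thesis .
qed

text \<open>Let \<open>K\<close> be the maximum of \<open>v\<close> divided by the weight. At the
  point where it is attained the integral term costs at most half of \<open>K\<close>, so
  \<open>K \<le> A + K / 2\<close>. Solving this gives the factor 2 in the bound, without any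
  iteration.\<close>

lemma gronwall_integral:
  fixes m v :: "real \<Rightarrow> real"
  assumes m: "m integrable_on {a..b}" and m0: "\<And>s. s \<in> {a..b} \<Longrightarrow> 0 \<le> m s"
    and v: "continuous_on {a..b} v" and v0: "\<And>s. s \<in> {a..b} \<Longrightarrow> 0 \<le> v s" and "A \<ge> 0"
    and le: "\<And>t. t \<in> {a..b} \<Longrightarrow> v t \<le> A + integral {a..t} (\<lambda>s. m s * v s)" and t: "t \<in> {a..b}"
  shows "v t \<le> 2 * A * exp (2 * integral {a..t} m)"
proof -
  define M where "M t = integral {a..t} m" for t
  have M0: "M s \<ge> 0" if "s \<in> {a..b}" for s
    using integral_nonneg[of m "{a..s}"] integrable_on_subinterval[OF m, of a s] m0 that by (auto simp: M_def)
  have "continuous_on {a..b} (\<lambda>s. v s * exp (- (2 * M s)))"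
    unfolding M_def using indefinite_integral_continuous_1[OF m] v by (intro continuous_intros)
  then obtain t0 where t0: "t0 \<in> {a..b}"
    "\<And>s. s \<in> {a..b} \<Longrightarrow> v s * exp (- (2 * M s)) \<le> v t0 * exp (- (2 * M t0))"
    using continuous_attains_sup[of "{a..b}" "\<lambda>s. v s * exp (- (2 * M s))"] t by fastforce
  define K where "K = v t0 * exp (- (2 * M t0))"
  have vK: "v s \<le> K * exp (2 * M s)" if "s \<in> {a..b}" for s
    using t0(2)[OF that] by (simp add: K_def exp_minus field_simps)
  have K0: "K \<ge> 0" using v0[OF t0(1)] by (simp add: K_def)
  have "v t0 \<le> A + K / 2 * exp (2 * M t0)"
    using le[OF t0(1)] integral_mult_exp_le[OF m m0 v K0 vK[unfolded M_def] t0(1)]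
    by (simp add: M_def)
  then have "K \<le> (A + K / 2 * exp (2 * M t0)) * exp (- (2 * M t0))"
    by (simp add: K_def)
  also have "\<dots> = A * exp (- (2 * M t0)) + K / 2"
    by (simp add: exp_minus field_simps)
  also have "\<dots> \<le> A + K / 2"
    using M0[OF t0(1)] \<open>A \<ge> 0\<close> by (simp add: mult_left_le)
  finally have "K \<le> 2 * A" by simp
  then have "K * exp (2 * M t) \<le> 2 * A * exp (2 * M t)" by (intro mult_right_mono) auto
  with vK[OF t] show ?thesis unfolding M_def by linarith
qed

text \<open>Picard iteration from a constant function. The weighted bound on successive differences
  halves at each step on all of \<open>{a..b}\<close> at once, which avoids gluing solutions on
  short intervals. The weight is bounded on \<open>{a..b}\<close>, so the convergence is
  uniform.\<close>

lemma caratheodory_existence: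
  fixes f :: "real \<Rightarrow> 'a::euclidean_space \<Rightarrow> 'a"
  assumes m: "m integrable_on {a..b}" and m0: "\<And>s. s \<in> {a..b} \<Longrightarrow> 0 \<le> m s"
    and int: "\<And>y. continuous_on {a..b} y \<Longrightarrow> (\<lambda>s. f s (y s)) integrable_on {a..b}"
    and lip: "\<And>s x y. s \<in> {a..b} \<Longrightarrow> norm (f s x - f s y) \<le> m s * norm (x - y)"
  obtains y where "continuous_on {a..b} y" "\<And>t. t \<in> {a..b} \<Longrightarrow> y t = \<xi> + integral {a..t} (\<lambda>s. f s (y s))"
proof -
  define Y where "Y = rec_nat (\<lambda>_. \<xi>) (\<lambda>_ y t. \<xi> + integral {a..t} (\<lambda>s. f s (y s)))"
  have Y: "Y 0 = (\<lambda>_. \<xi>)" "Y (Suc n) = (\<lambda>t. \<xi> + integral {a..t} (\<lambda>s. f s (Y n s)))" for n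
    by (simp_all add: Y_def)
  have cY: "continuous_on {a..b} (Y n)" for n
  proof (induction n)
    case 0
    then show ?case by (simp add: Y)
  next
    case (Suc n)
    then show ?case
      unfolding Y by (intro continuous_intros indefinite_integral_continuous_1 int)
  qed
  define M where "M t = integral {a..t} m" for t
  have M_bound: "M s \<in> {0..M b}" if "s \<in> {a..b}" for s
  proof -
    have ms: "m integrable_on {a..s}" using integrable_on_subinterval[OF m] that by auto
    show ?thesis
      using integral_nonneg[OF ms] integral_subset_le[OF _ ms m] m0 that by (auto simp: M_def)
  qed
  have diff: "norm (integral {a..t} (\<lambda>s. f s (y s)) - integral {a..t} (\<lambda>s. f s (z s)))
      \<le> integral {a..t} (\<lambda>s. m s * norm (y s - z s))"
    if yz: "continuous_on {a..b} y" "continuous_on {a..b} z" and t: "t \<in> {a..b}" for y z t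
  proof -
    have i: "(\<lambda>s. f s (y s)) integrable_on {a..t}" "(\<lambda>s. f s (z s)) integrable_on {a..t}"
      "(\<lambda>s. m s * norm (y s - z s)) integrable_on {a..t}"
      using integrable_on_subinterval[OF int[OF yz(1)], of a t] integrable_on_subinterval[OF int[OF yz(2)], of a t]
        integrable_mult_norm_diff[OF m m0 yz t] t
      by auto
    show ?thesis
      using t by (subst integral_diff[symmetric]) (auto intro!: integral_norm_bound_integral integrable_diff i lip)
  qed
  have "bounded ((\<lambda>t. Y 1 t - Y 0 t) ` {a..b})"
    by (intro compact_imp_bounded compact_continuous_image continuous_intros cY) auto
  then obtain C where C: "\<And>t. t \<in> {a..b} \<Longrightarrow> norm (Y 1 t - Y 0 t) \<le> C" "C > 0"
    unfolding bounded_pos by blast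
  have step: "norm (Y (Suc n) t - Y n t) \<le> C * (1/2) ^ n * exp (2 * M t)" if "t \<in> {a..b}" for n t
    using that
  proof (induction n arbitrary: t)
    case 0
    have "C * 1 \<le> C * exp (2 * M t)"
      using C(2) M_bound[OF 0] by (intro mult_left_mono) auto
    then show ?case using C(1)[OF 0] by simp
  next
    case (Suc n)
    have "norm (Y (Suc (Suc n)) t - Y (Suc n) t) \<le> integral {a..t} (\<lambda>s. m s * norm (Y (Suc n) s - Y n s))"
      using diff[OF cY[of "Suc n"] cY[of n] Suc.prems] by (simp add: Y(2)[of "Suc n"] Y(2)[of n])
    also have "\<dots> \<le> (C * (1/2) ^ n) / 2 * exp (2 * integral {a..t} m)"
      using Suc C(2) unfolding M_def
      by (intro integral_mult_exp_le[OF m m0]) (auto intro!: continuous_intros cY)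
    finally show ?case by (simp add: M_def)
  qed
  \<comment> \<open>Writing the limit of the iterates as a telescoping series opens it to the
    Weierstrass test.\<close>
  define y where "y t = \<xi> + (\<Sum>i. Y (Suc i) t - Y i t)" for t
  have "uniform_limit {a..b} (\<lambda>n t. \<Sum>i<n. Y (Suc i) t - Y i t) (\<lambda>t. \<Sum>i. Y (Suc i) t - Y i t) sequentially"
  proof (rule Weierstrass_m_test)
    show "norm (Y (Suc n) t - Y n t) \<le> C * exp (2 * M b) * (1/2) ^ n" if "t \<in> {a..b}" for n t
    proof -
      have "C * (1/2) ^ n * exp (2 * M t) \<le> C * (1/2) ^ n * exp (2 * M b)"
        using M_bound[OF that] C(2) by (intro mult_left_mono) auto
      with step[OF that, of n] show ?thesis by (simp add: mult_ac)
    qed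
    show "summable (\<lambda>n. C * exp (2 * M b) * (1 / 2) ^ n)"
      by (intro summable_mult summable_geometric) simp
  qed
  moreover have "(\<Sum>i<n. Y (Suc i) t - Y i t) = Y n t - Y 0 t" for n t
    by (rule sum_lessThan_telescope[of "\<lambda>i. Y i t"])
  ultimately have "uniform_limit {a..b} (\<lambda>n t. Y n t - Y 0 t) (\<lambda>t. \<Sum>i. Y (Suc i) t - Y i t) sequentially"
    by simp
  then have "uniform_limit {a..b} (\<lambda>n t. \<xi> + (Y n t - Y 0 t)) y sequentially"
    unfolding y_def by (intro uniform_limit_intros)
  then have ul: "uniform_limit {a..b} Y y sequentially" by (simp add: Y(1))
  have cy: "continuous_on {a..b} y"
    by (rule uniform_limit_theorem[OF _ ul]) (auto intro!: always_eventually cY)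
  moreover have "y t = \<xi> + integral {a..t} (\<lambda>s. f s (y s))" if t: "t \<in> {a..b}" for t
  proof (rule LIMSEQ_unique)
    show "(\<lambda>n. Y (Suc n) t) \<longlonglongrightarrow> y t"
      using tendsto_uniform_limitI[OF ul t] by (rule LIMSEQ_Suc)
    have "(\<lambda>n. integral {a..t} (\<lambda>s. f s (Y n s))) \<longlonglongrightarrow> integral {a..t} (\<lambda>s. f s (y s))"
    proof (rule tendstoI)
      fix e :: real assume "e > 0"
      \<comment> \<open>The \<open>+ 1\<close> guards against a vanishing integral of
        \<open>m\<close>.\<close>
      define e1 where "e1 = e / (M b + 1)"
      have Mb: "M b \<ge> 0" using M_bound[OF t] by auto
      have "e1 > 0" using \<open>e > 0\<close> Mb by (simp add: e1_def)
      from uniform_limitD[OF ul this]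
      show "\<forall>\<^sub>F n in sequentially. dist (integral {a..t} (\<lambda>s. f s (Y n s))) (integral {a..t} (\<lambda>s. f s (y s))) < e"
      proof eventually_elim
        case (elim n)
        have ms: "m integrable_on {a..t}" using integrable_on_subinterval[OF m] t by auto
        have "norm (integral {a..t} (\<lambda>s. f s (Y n s)) - integral {a..t} (\<lambda>s. f s (y s)))
          \<le> integral {a..t} (\<lambda>s. m s * norm (Y n s - y s))"
          by (rule diff[OF cY cy t])
        also have "\<dots> \<le> integral {a..t} (\<lambda>s. m s * e1)"
        proof (rule integral_le)
          show "(\<lambda>s. m s * norm (Y n s - y s)) integrable_on {a..t}"
            by (rule integrable_mult_norm_diff[OF m m0 cY cy t])
          show "(\<lambda>s. m s * e1) integrable_on {a..t}" using ms by (rule integrable_on_mult_left)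
          show "m s * norm (Y n s - y s) \<le> m s * e1" if "s \<in> {a..t}" for s
            using elim that m0 t by (intro mult_left_mono) (auto simp: dist_norm less_imp_le)
        qed
        also have "\<dots> = M t * e1" by (simp add: M_def)
        also have "\<dots> \<le> M b * e1" using M_bound[OF t] \<open>e1 > 0\<close> by (intro mult_right_mono) auto
        also have "\<dots> < e" using \<open>e > 0\<close> Mb by (simp add: e1_def field_simps)
        finally show ?case by (simp add: dist_norm)
      qed
    qed
    then show "(\<lambda>n. Y (Suc n) t) \<longlonglongrightarrow> \<xi> + integral {a..t} (\<lambda>s. f s (y s))"
      unfolding Y by (intro tendsto_intros)
  qed
  ultimately show ?thesis by (rule that)
qed

section \<open>Weak compactness in \<open>L\<^sup>2\<close>\<close>

text \<open>The sum of the norms of the increments has finite integral, hence is finite almost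
  everywhere. The formula for \<open>u\<close> does not mention \<open>M\<close>, so one limit
  function serves several measures at once.\<close>

lemma telescoping_series_integral:
  fixes v :: "nat \<Rightarrow> 'a \<Rightarrow> 'b::{banach, second_countable_topology}"
  assumes int: "\<And>n. integrable M (v n)"
    and le: "\<And>n. (\<integral>x. norm (v (Suc n) x - v n x) \<partial>M) \<le> b n" and b: "summable b"
  defines "u \<equiv> \<lambda>x. v 0 x + (\<Sum>i. v (Suc i) x - v i x)"
  shows "AE x in M. (\<lambda>n. v n x) \<longlonglongrightarrow> u x" and "(\<lambda>n. integral\<^sup>L M (v n)) \<longlonglongrightarrow> integral\<^sup>L M u"
proof -
  define w where "w n x = v (Suc n) x - v n x" for n x
  have wi: "integrable M (w n)" for n unfolding w_def[abs_def] by (intro Bochner_Integration.integrable_diff int)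
  have b0: "0 \<le> b n" for n
    using le[of n] by (meson integral_nonneg norm_ge_zero order_trans Bochner_Integration.integral_nonneg)
  have "(\<integral>\<^sup>+x. (\<Sum>i. ennreal (norm (w i x))) \<partial>M) = (\<Sum>i. \<integral>\<^sup>+x. ennreal (norm (w i x)) \<partial>M)"
    using wi by (intro nn_integral_suminf) auto
  also have "\<dots> = (\<Sum>i. ennreal (\<integral>x. norm (w i x) \<partial>M))"
    using wi by (intro arg_cong[where f=suminf] ext nn_integral_eq_integral) auto
  also have "\<dots> \<le> (\<Sum>i. ennreal (b i))"
    using le by (intro suminf_le) (auto simp: w_def intro!: ennreal_leI)
  also have "\<dots> = ennreal (\<Sum>i. b i)" using b b0 by (intro suminf_ennreal2) auto
  finally have "(\<integral>\<^sup>+x. (\<Sum>i. ennreal (norm (w i x))) \<partial>M) \<noteq> \<infinity>"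
    by (auto simp: top_unique)
  then have "AE x in M. (\<Sum>i. ennreal (norm (w i x))) \<noteq> \<infinity>"
    using wi by (intro nn_integral_PInf_AE) auto
  then have AEs: "AE x in M. summable (\<lambda>i. norm (w i x))"
    by (rule AE_mp) (intro AE_I2 impI summable_suminf_not_top, simp_all)
  have tel: "(\<Sum>i<n. w i x) = v n x - v 0 x" for n x
    unfolding w_def by (rule sum_lessThan_telescope[of "\<lambda>i. v i x"])
  show "AE x in M. (\<lambda>n. v n x) \<longlonglongrightarrow> u x"
    using AEs
  proof eventually_elim
    case (elim x)
    then have "(\<lambda>i. w i x) sums (\<Sum>i. w i x)" 
      by (rule summable_sums[OF summable_norm_cancel])
    then have "(\<lambda>n. v n x - v 0 x) \<longlonglongrightarrow> (\<Sum>i. w i x)" unfolding sums_def tel .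
    from tendsto_add[OF tendsto_const[of "v 0 x"] this] show ?case
      by (simp add: u_def w_def)
  qed
  have s: "summable (\<lambda>i. \<integral>x. norm (w i x) \<partial>M)"
    using le by (intro summable_comparison_test'[OF b, of 0]) (auto simp: w_def integral_nonneg_AE)
  have "(\<lambda>i. integral\<^sup>L M (w i)) sums (\<integral>x. (\<Sum>i. w i x) \<partial>M)"
    by (rule sums_integral[OF wi AEs s])
  moreover have "(\<Sum>i<n. integral\<^sup>L M (w i)) = integral\<^sup>L M (v n) - integral\<^sup>L M (v 0)" for n
    unfolding w_def using sum_lessThan_telescope[of "\<lambda>i. integral\<^sup>L M (v i)"] int
    by (simp add: Bochner_Integration.integral_diff)
  ultimately have "(\<lambda>n. integral\<^sup>L M (v n) - integral\<^sup>L M (v 0)) \<longlonglongrightarrow> (\<integral>x. (\<Sum>i. w i x) \<partial>M)"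
    by (simp add: sums_def)
  from tendsto_add[OF tendsto_const[of "integral\<^sup>L M (v 0)"] this]
  have "(\<lambda>n. integral\<^sup>L M (v n)) \<longlonglongrightarrow> integral\<^sup>L M (v 0) + (\<integral>x. (\<Sum>i. w i x) \<partial>M)" by simp
  also have "integral\<^sup>L M (v 0) + (\<integral>x. (\<Sum>i. w i x) \<partial>M) = integral\<^sup>L M u"
    unfolding u_def w_def[symmetric]
    by (rule Bochner_Integration.integral_add[symmetric, OF int integrable_suminf[OF wi AEs s]])
  finally show "(\<lambda>n. integral\<^sup>L M (v n)) \<longlonglongrightarrow> integral\<^sup>L M u" .
qed

section \<open>Square-integrable controls\<close>

lemma norm_add_square_le: "(norm (x + y))\<^sup>2 \<le> 2 * (norm x)\<^sup>2 + 2 * (norm y)\<^sup>2" for x y :: "'a::real_inner"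
  using inner_ge_zero[of "x - y"]
  by (simp add: power2_norm_eq_inner inner_add inner_diff algebra_simps inner_commute)

lemma L2_controlsD:
  assumes "u \<in> L2_controls"
  shows "u \<in> borel_measurable (lebesgue_on {0..1})" "integrable (lebesgue_on {0..1}) (\<lambda>t. (norm (u t))\<^sup>2)"
  using assms by (auto simp: L2_controls_def)

lemma L2_norm_square: "(L2_norm u)\<^sup>2 = (LINT t|lebesgue_on {0..1}. (norm (u t))\<^sup>2)"
  by (simp add: L2_norm_def integral_nonneg_AE)

lemma L2_controls_scaleR: "u \<in> L2_controls \<Longrightarrow> (\<lambda>t. c *\<^sub>R u t) \<in> L2_controls"
  by (auto simp: L2_controls_def power_mult_distrib)

lemma L2_controls_add:
  assumes u: "u \<in> L2_controls" and v: "v \<in> L2_controls"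
  shows "(\<lambda>t. u t + v t) \<in> L2_controls"
proof -
  note [measurable] = L2_controlsD(1)[OF u] L2_controlsD(1)[OF v]
  have "integrable (lebesgue_on {0..1}) (\<lambda>t. (norm (u t + v t))\<^sup>2)"
  proof (rule Bochner_Integration.integrable_bound)
    show "integrable (lebesgue_on {0..1}) (\<lambda>t. 2 * (norm (u t))\<^sup>2 + 2 * (norm (v t))\<^sup>2)"
      using L2_controlsD(2)[OF u] L2_controlsD(2)[OF v] by auto
    show "AE t in lebesgue_on {0..1}. norm ((norm (u t + v t))\<^sup>2) \<le> norm (2 * (norm (u t))\<^sup>2 + 2 * (norm (v t))\<^sup>2)"
      by (simp add: norm_add_square_le)
  qed measurable
  then show ?thesis by (simp add: L2_controls_def)
qed

lemma L2_controls_diff: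
  assumes "u \<in> L2_controls" "v \<in> L2_controls"
  shows "(\<lambda>t. u t - v t) \<in> L2_controls"
  using L2_controls_add[OF assms(1) L2_controls_scaleR[OF assms(2), of "-1"]] by simp

lemma L2_norm_scaleR_square: "(L2_norm (\<lambda>t. c *\<^sub>R u t))\<^sup>2 = c\<^sup>2 * (L2_norm u)\<^sup>2"
  by (simp add: L2_norm_square power_mult_distrib)

text \<open>Serves to show that controls of almost minimal norm in a convex set are close to each
  other.\<close>

lemma L2_norm_parallelogram:
  assumes u: "u \<in> L2_controls" and v: "v \<in> L2_controls"
  shows "(L2_norm (\<lambda>t. u t + v t))\<^sup>2 + (L2_norm (\<lambda>t. u t - v t))\<^sup>2 = 2 * (L2_norm u)\<^sup>2 + 2 * (L2_norm v)\<^sup>2"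
proof -
  have "(L2_norm (\<lambda>t. u t + v t))\<^sup>2 + (L2_norm (\<lambda>t. u t - v t))\<^sup>2
      = (LINT t|lebesgue_on {0..1}. (norm (u t + v t))\<^sup>2 + (norm (u t - v t))\<^sup>2)"
    unfolding L2_norm_square
    using L2_controlsD(2)[OF L2_controls_add[OF u v]] L2_controlsD(2)[OF L2_controls_diff[OF u v]]
    by simp
  also have "\<dots> = (LINT t|lebesgue_on {0..1}. 2 * (norm (u t))\<^sup>2 + 2 * (norm (v t))\<^sup>2)"
    by (intro Bochner_Integration.integral_cong)
       (auto simp: power2_norm_eq_inner inner_add inner_diff inner_commute algebra_simps)
  also have "\<dots> = 2 * (L2_norm u)\<^sup>2 + 2 * (L2_norm v)\<^sup>2"
    unfolding L2_norm_square using L2_controlsD(2)[OF u] L2_controlsD(2)[OF v] by simp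
  finally show ?thesis .
qed

text \<open>Either \<open>norm x \<le> \<kappa>\<close>, or one factor of the square dominates the
  divisor \<open>\<kappa>\<close>.\<close>

lemma norm_le_add_square_div: "norm x \<le> \<kappa> + (norm x)\<^sup>2 / \<kappa>" if "\<kappa> > 0"
proof (cases "norm x \<le> \<kappa>")
  case True
  moreover have "0 \<le> (norm x)\<^sup>2 / \<kappa>" using that by simp
  ultimately show ?thesis by linarith
next
  case False
  then have "norm x * \<kappa> \<le> (norm x)\<^sup>2" by (simp add: power2_eq_square mult_left_mono)
  then have "norm x \<le> (norm x)\<^sup>2 / \<kappa>" using that by (simp add: field_simps)
  then show ?thesis using that by linarith
qed

lemma L2_controls_integrable:
  assumes u: "u \<in> L2_controls"
  shows "integrable (lebesgue_on {0..1}) (\<lambda>t. norm (u t))" "integrable (lebesgue_on {0..1}) u"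
    "u absolutely_integrable_on {0..1}"
proof -
  note [measurable] = L2_controlsD(1)[OF u]
  show 1: "integrable (lebesgue_on {0..1}) (\<lambda>t. norm (u t))"
  proof (rule Bochner_Integration.integrable_bound)
    show "integrable (lebesgue_on {0..1}) (\<lambda>t. 1 + (norm (u t))\<^sup>2 / 1)"
      using L2_controlsD(2)[OF u]
      by (intro Bochner_Integration.integrable_add integrable_divide)
         (auto intro!: finite_measure.integrable_const finite_measureI simp: emeasure_restrict_space)
    show "AE t in lebesgue_on {0..1}. norm (norm (u t)) \<le> norm (1 + (norm (u t))\<^sup>2 / 1)"
      using norm_le_add_square_div[of 1] by (auto intro!: always_eventually)
  qed measurable
  then show "integrable (lebesgue_on {0..1}) u"
    using integrable_norm_iff[of u "lebesgue_on {0..1}"] by simp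
  show "u absolutely_integrable_on {0..1}"
    using 1 by (simp add: absolutely_integrable_measurable o_def)
qed

text \<open>The last term does not depend on the subinterval: a large \<open>\<kappa>\<close> makes
  it small, and a short interval then makes the first term small. This yields equicontinuity of
  primitives; \<open>\<kappa> = 1\<close> yields plain L1 bounds.\<close>

lemma L2_controls_integral_norm_le:
  assumes u: "u \<in> L2_controls" and "\<kappa> > 0" "0 \<le> s" "s \<le> t" "t \<le> 1"
  shows "integral {s..t} (\<lambda>t. norm (u t)) \<le> \<kappa> * (t - s) + (L2_norm u)\<^sup>2 / \<kappa>"
proof -
  have sub: "{s..t} \<subseteq> {0..1}" using assms by auto
  have n: "(\<lambda>t. norm (u t)) integrable_on {0..1}"
    using integrable_on_lebesgue_on[OF L2_controls_integrable(1)[OF u]] by simp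
  have q: "(\<lambda>t. (norm (u t))\<^sup>2) integrable_on {0..1}"
    using integrable_on_lebesgue_on[OF L2_controlsD(2)[OF u]] by simp
  have q': "(\<lambda>t. (norm (u t))\<^sup>2 / \<kappa>) integrable_on {s..t}"
    using integrable_on_divide[OF integrable_on_subinterval[OF q sub]] .
  have "integral {s..t} (\<lambda>t. norm (u t)) \<le> integral {s..t} (\<lambda>t. \<kappa> + (norm (u t))\<^sup>2 / \<kappa>)"
    by (intro integral_le integrable_add q' integrable_on_subinterval[OF n sub] integrable_const_ivl
        norm_le_add_square_div \<open>\<kappa> > 0\<close>)
  also have "\<dots> = \<kappa> * (t - s) + integral {s..t} (\<lambda>t. (norm (u t))\<^sup>2) / \<kappa>"
    using \<open>s \<le> t\<close> q' by (subst integral_add) auto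
  also have "\<dots> \<le> \<kappa> * (t - s) + integral {0..1} (\<lambda>t. (norm (u t))\<^sup>2) / \<kappa>"
    using \<open>\<kappa> > 0\<close> by (intro add_left_mono divide_right_mono integral_subset_le sub q integrable_on_subinterval[OF q sub]) auto
  also have "integral {0..1} (\<lambda>t. (norm (u t))\<^sup>2) = (L2_norm u)\<^sup>2"
    unfolding L2_norm_square using L2_controlsD(2)[OF u] by (simp add: lebesgue_integral_eq_integral)
  finally show ?thesis .
qed

lemma integrable_on_subinterval_unit:
  assumes "u \<in> L2_controls" "0 \<le> s" "t \<le> 1"
  shows "u integrable_on {s..t}" "(\<lambda>t. norm (u t)) integrable_on {s..t}"
  using L2_controls_integrable(3)[OF assms(1)] assms
  by (auto simp: absolutely_integrable_on_def intro!: integrable_on_subinterval[of _ "{0..1}"])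

text \<open>A substitute for completeness of L2 that avoids convergence in norm: increments of
  geometrically decreasing L2 norm are summable in L1, which gives a limit almost everywhere and
  convergence of the primitives, and Fatou's lemma bounds the norm of the limit.\<close>

lemma L2_series_limit:
  fixes v :: "nat \<Rightarrow> real \<Rightarrow> real^'k"
  assumes v: "\<And>n. v n \<in> L2_controls"
    and cauchy: "\<And>n. (L2_norm (\<lambda>t. v (Suc n) t - v n t))\<^sup>2 \<le> (1/4) ^ n"
    and le: "\<And>n. (L2_norm (v n))\<^sup>2 \<le> c n" and c: "c \<longlonglongrightarrow> d"
  obtains u where "u \<in> L2_controls" "(L2_norm u)\<^sup>2 \<le> d"
    "\<And>t. t \<in> {0..1} \<Longrightarrow> (\<lambda>n. integral {0..t} (v n)) \<longlonglongrightarrow> integral {0..t} u"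
proof -
  define u where "u = (\<lambda>x. v 0 x + (\<Sum>i. v (Suc i) x - v i x))"
  have vi: "integrable (lebesgue_on {0..t}) (v n)" if "t \<in> {0..1}" for t n
    using integrable_subinterval[OF L2_controls_integrable(2)[OF v]] that by auto
  have bnd: "(\<integral>x. norm (v (Suc n) x - v n x) \<partial>lebesgue_on {0..t}) \<le> 2 * (1/2)^n" if t: "t \<in> {0..1}" for t n
  proof -
    have "(\<integral>x. norm (v (Suc n) x - v n x) \<partial>lebesgue_on {0..t}) = integral {0..t} (\<lambda>x. norm (v (Suc n) x - v n x))"
      using vi[OF t] by (intro lebesgue_integral_eq_integral) auto
    \<comment> \<open>The choice \<open>\<kappa> = (1/2)^n\<close> balances the two terms, as the
      squared L2 norm is at most \<open>(1/4)^n\<close>.\<close>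
    also have "\<dots> \<le> (1/2)^n * (t - 0) + (L2_norm (\<lambda>t. v (Suc n) t - v n t))\<^sup>2 / (1/2)^n"
      using t by (intro L2_controls_integral_norm_le L2_controls_diff v) auto
    also have "\<dots> \<le> (1/2)^n * 1 + (1/4)^n / (1/2)^n"
      using t cauchy by (intro add_mono mult_left_mono divide_right_mono) auto
    also have "\<dots> = 2 * (1/2::real)^n" by (simp add: power_divide[symmetric])
    finally show ?thesis .
  qed
  have sm: "summable (\<lambda>n. 2 * (1/2::real)^n)" by (intro summable_mult summable_geometric) simp
  \<comment> \<open>One application for each \<open>t\<close>, all sharing the same
    \<open>u\<close>.\<close>
  have lim: "AE x in lebesgue_on {0..t}. (\<lambda>n. v n x) \<longlonglongrightarrow> u x"
     "(\<lambda>n. integral\<^sup>L (lebesgue_on {0..t}) (v n)) \<longlonglongrightarrow> integral\<^sup>L (lebesgue_on {0..t}) u" if "t \<in> {0..1}" for t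
    using telescoping_series_integral[of "lebesgue_on {0..t}" v, OF vi[OF that] bnd[OF that] sm]
    unfolding u_def by auto
  note [measurable] = L2_controlsD(1)[OF v]
  have um[measurable]: "u \<in> borel_measurable (lebesgue_on {0..1})"
    unfolding u_def by measurable
  \<comment> \<open>\<open>ennreal\<close> sends negative numbers to \<open>0\<close>, so the sign
    of \<open>d\<close> is needed to return to a bound between reals.\<close>
  have d0: "d \<ge> 0"
    using order_trans[OF zero_le_power2 le] by (intro LIMSEQ_le_const[OF c]) blast
  have "(\<integral>\<^sup>+t. ennreal ((norm (u t))\<^sup>2) \<partial>lebesgue_on {0..1})
      = (\<integral>\<^sup>+t. liminf (\<lambda>n. ennreal ((norm (v n t))\<^sup>2)) \<partial>lebesgue_on {0..1})"
  proof (rule nn_integral_cong_AE)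
    show "AE t in lebesgue_on {0..1}. ennreal ((norm (u t))\<^sup>2) = liminf (\<lambda>n. ennreal ((norm (v n t))\<^sup>2))"
      using lim(1)[of 1, simplified]
    proof eventually_elim
      case (elim t)
      then have "(\<lambda>n. ennreal ((norm (v n t))\<^sup>2)) \<longlonglongrightarrow> ennreal ((norm (u t))\<^sup>2)"
        by (intro tendsto_intros)
      from lim_imp_Liminf[OF _ this] show ?case by simp
    qed
  qed
  also have "\<dots> \<le> liminf (\<lambda>n. \<integral>\<^sup>+t. ennreal ((norm (v n t))\<^sup>2) \<partial>lebesgue_on {0..1})"
    by (rule nn_integral_liminf) measurable
  also have "\<dots> = liminf (\<lambda>n. ennreal ((L2_norm (v n))\<^sup>2))"
    unfolding L2_norm_square using L2_controlsD(2)[OF v] by (simp add: nn_integral_eq_integral)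
  also have "\<dots> \<le> liminf (\<lambda>n. ennreal (c n))"
    by (intro Liminf_mono always_eventually) (auto intro!: ennreal_leI le)
  also have "\<dots> = ennreal d"
    using c by (intro lim_imp_Liminf tendsto_ennrealI) auto
  finally have nn: "(\<integral>\<^sup>+t. ennreal ((norm (u t))\<^sup>2) \<partial>lebesgue_on {0..1}) \<le> ennreal d" .
  have ui: "integrable (lebesgue_on {0..1}) (\<lambda>t. (norm (u t))\<^sup>2)"
    using nn by (intro integrableI_bounded) (auto simp: le_less_trans[OF _ ennreal_less_top])
  then have uL2: "u \<in> L2_controls" by (simp add: L2_controls_def um)
  moreover have "(L2_norm u)\<^sup>2 \<le> d"
    using nn d0 ui unfolding L2_norm_square by (subst (asm) nn_integral_eq_integral) auto
  moreover have "(\<lambda>n. integral {0..t} (v n)) \<longlonglongrightarrow> integral {0..t} u" if t: "t \<in> {0..1}" for t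
    using lim(2)[OF t] vi[OF t] integrable_subinterval[OF L2_controls_integrable(2)[OF uL2], of 0 t] t
    by (simp add: lebesgue_integral_eq_integral)
  ultimately show ?thesis by (rule that)
qed

text \<open>The increments of the primitives are bounded uniformly in \<open>n\<close>, so
  Arzela-Ascoli applies. Only a limit \<open>U\<close> is claimed; that it is the primitive of a
  control is settled in \<open>L2_weak_compactness\<close>.\<close>

lemma bounded_L2_primitives_convergent_subsequence:
  fixes u :: "nat \<Rightarrow> real \<Rightarrow> real^'k"
  assumes u: "\<And>n. u n \<in> L2_controls" and C: "\<And>n. (L2_norm (u n))\<^sup>2 \<le> C"
  obtains r U where "strict_mono (r :: nat \<Rightarrow> nat)"
    "\<And>e. e > 0 \<Longrightarrow> \<exists>N. \<forall>n\<ge>N. \<forall>t\<in>{0..1}. norm (integral {0..t} (u (r n)) - U t) \<le> e"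
proof -
  have C0: "C \<ge> 0" using C[of 0] by (meson order_trans zero_le_power2)
  have incr: "norm (integral {0..t} (u n) - integral {0..s} (u n)) \<le> \<kappa> * (t - s) + C / \<kappa>"
    if "\<kappa> > 0" "0 \<le> s" "s \<le> t" "t \<le> 1" for \<kappa> s t n
  proof -
    have i: "u n integrable_on {0..t}" "u n integrable_on {s..t}"
      "(\<lambda>t. norm (u n t)) integrable_on {s..t}"
      using integrable_on_subinterval_unit[OF u] that by auto
    have "integral {0..t} (u n) - integral {0..s} (u n) = integral {s..t} (u n)"
      using Henstock_Kurzweil_Integration.integral_combine[of 0 s t "u n"] i that by (auto simp: algebra_simps)
    also have "norm \<dots> \<le> integral {s..t} (\<lambda>t. norm (u n t))"
      by (rule integral_norm_bound_integral[OF i(2,3)]) simp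
    also have "\<dots> \<le> \<kappa> * (t - s) + (L2_norm (u n))\<^sup>2 / \<kappa>"
      by (rule L2_controls_integral_norm_le[OF u that])
    also have "\<dots> \<le> \<kappa> * (t - s) + C / \<kappa>"
      using C that by (intro add_left_mono divide_right_mono) auto
    finally show ?thesis .
  qed
  obtain g r where "continuous_on {0..1} g" "strict_mono (r :: nat \<Rightarrow> nat)"
      "\<And>e. 0 < e \<Longrightarrow> \<exists>N. \<forall>n t. n \<ge> N \<and> t \<in> {0..1} \<longrightarrow> norm (integral {0..t} (u (r n)) - g t) < e"
  proof (rule Arzela_Ascoli[of "{0..1::real}" "\<lambda>n t. integral {0..t} (u n)" "1 + C"])
    show "norm (integral {0..t} (u n)) \<le> 1 + C" if "t \<in> {0..1}" for n t
      using incr[of 1 0 t n] that by auto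
    show "\<exists>d>0. \<forall>n y. y \<in> {0..1} \<and> norm (x - y) < d \<longrightarrow> norm (integral {0..x} (u n) - integral {0..y} (u n)) < e"
      if "x \<in> {0..1}" "0 < e" for x e
    proof -
      \<comment> \<open>Makes \<open>C / \<kappa>\<close> smaller than \<open>e / 2\<close>, leaving
        \<open>e / 2\<close> for the term proportional to the distance. \<open>C + 1\<close> keeps
        \<open>\<kappa>\<close> positive when \<open>C = 0\<close>.\<close>
      define \<kappa> where "\<kappa> = 2 * (C + 1) / e"
      have \<kappa>: "\<kappa> > 0" using that C0 by (simp add: \<kappa>_def)
      have "C / \<kappa> < e / 2" using that C0 by (simp add: \<kappa>_def field_simps)
      show ?thesis
      proof (intro exI[of _ "e / (2 * \<kappa>)"] conjI allI impI)
        show "0 < e / (2 * \<kappa>)" using \<kappa> that by simp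
        fix n y assume y: "y \<in> {0..1} \<and> norm (x - y) < e / (2 * \<kappa>)"
        then have "\<kappa> * \<bar>x - y\<bar> < e / 2" using \<kappa> by (simp add: field_simps)
        moreover have "norm (integral {0..x} (u n) - integral {0..y} (u n)) \<le> \<kappa> * \<bar>x - y\<bar> + C / \<kappa>"
          using incr[OF \<kappa>, of x y n] incr[OF \<kappa>, of y x n] y that
          by (cases "x \<le> y") (auto simp: norm_minus_commute)
        ultimately show "norm (integral {0..x} (u n) - integral {0..y} (u n)) < e"
          using \<open>C / \<kappa> < e / 2\<close> by linarith
      qed
    qed
  qed auto
  then show ?thesis by (intro that[of r g]) (assumption, meson less_imp_le)
qed

text \<open>The weak limit is found as the strong limit of elements of almost minimal norm in the decreasing
  convex sets of all controls whose primitive is uniformly close to the limit of the primitives.\<close>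

lemma L2_weak_compactness:
  fixes u :: "nat \<Rightarrow> real \<Rightarrow> real^'k"
  assumes u: "\<And>n. u n \<in> L2_controls" and c: "(\<lambda>n. (L2_norm (u n))\<^sup>2) \<longlonglongrightarrow> c"
  obtains r v where "strict_mono (r :: nat \<Rightarrow> nat)" "v \<in> L2_controls" "(L2_norm v)\<^sup>2 \<le> c"
    "\<And>e. e > 0 \<Longrightarrow> \<exists>N. \<forall>n\<ge>N. \<forall>t\<in>{0..1}. norm (integral {0..t} (u (r n)) - integral {0..t} v) \<le> e"
proof -
  obtain C where C: "\<And>n. (L2_norm (u n))\<^sup>2 \<le> C"
    using convergent_imp_Bseq[OF convergentI[OF c]] unfolding Bseq_def by auto
  obtain r U where r: "strict_mono (r :: nat \<Rightarrow> nat)"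
    and U: "\<And>e. e > 0 \<Longrightarrow> \<exists>N. \<forall>n\<ge>N. \<forall>t\<in>{0..1}. norm (integral {0..t} (u (r n)) - U t) \<le> e"
    using bounded_L2_primitives_convergent_subsequence[of u C, OF u C] by metis
  define e where "e n = 1 / (real n + 1)" for n
  have e: "e n > 0" "n \<le> m \<Longrightarrow> e m \<le> e n" for n m by (auto simp: e_def field_simps)
  have e_lim: "e \<longlonglongrightarrow> 0" 
    using LIMSEQ_inverse_real_of_nat by (simp add: e_def[abs_def] inverse_eq_divide add.commute)
  \<comment> \<open>The tolerance \<open>e n\<close> is positive because no control is known yet to
    have primitive \<open>U\<close>; it ensures that every \<open>S n\<close> contains a tail of the
    subsequence.\<close>
  define S where "S n = {v \<in> L2_controls. \<forall>t\<in>{0..1}. norm (integral {0..t} v - U t) \<le> e n}" for n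
  define d where "d n = (INF v\<in>S n. (L2_norm v)\<^sup>2)" for n
  have bdd: "bdd_below ((\<lambda>v. (L2_norm v)\<^sup>2) ` X)" for X :: "(real \<Rightarrow> real^'k) set"
    by (rule bdd_belowI2[of _ 0]) simp
  have rS: "\<exists>N. \<forall>k\<ge>N. u (r k) \<in> S n" for n
    using U[OF e(1)[of n]] u by (auto simp: S_def)
  have S_mono: "S m \<subseteq> S n" if "n \<le> m" for n m
    using e(2)[OF that] by (force simp: S_def)
  have S_ne: "S n \<noteq> {}" for n using rS[of n] by auto
  have d_le: "d n \<le> (L2_norm v)\<^sup>2" if "v \<in> S n" for n v
    unfolding d_def using that by (intro cINF_lower bdd)
  have d_inc: "incseq d"
    unfolding incseq_def d_def using S_mono S_ne by (intro allI impI cINF_superset_mono bdd) auto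
  \<comment> \<open>For fixed \<open>n\<close> the tail of the subsequence lies in
    \<open>S n\<close>, so the infimum is at most the limit of the squared norms.\<close>
  have d_c: "d n \<le> c" for n
  proof (rule LIMSEQ_le_const[OF LIMSEQ_subseq_LIMSEQ[OF c r]])
    show "\<exists>N. \<forall>k\<ge>N. d n \<le> ((\<lambda>n. (L2_norm (u n))\<^sup>2) \<circ> r) k"
      using rS[of n] d_le[of _ n] by auto
  qed
  obtain D where D: "d \<longlonglongrightarrow> D" "\<And>n. d n \<le> D"
    using incseq_convergent[OF d_inc] d_c by metis
  have "D \<le> c" using d_c by (intro LIMSEQ_le_const2[OF D(1)]) auto
  have "\<exists>v\<in>S n. (L2_norm v)\<^sup>2 < d n + e n" for n
    using cINF_less_iff[OF S_ne[of n] bdd, of "d n + e n"] e(1)[of n] by (simp add: d_def)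
  then obtain v where vS: "\<And>n. v n \<in> S n" and v_lt: "\<And>n. (L2_norm (v n))\<^sup>2 < d n + e n" by metis
  have vL: "v n \<in> L2_controls" for n using vS[of n] by (simp add: S_def)
  \<comment> \<open>As in the Hilbert projection theorem: the midpoint of \<open>v m\<close> and
    \<open>v n\<close> lies in the convex set \<open>S n\<close>, so its squared norm is at least
    \<open>d n\<close>, and the parallelogram law turns this into closeness.\<close>
  have close: "(L2_norm (\<lambda>t. v m t - v n t))\<^sup>2 \<le> 2 * D - 2 * d n + 4 * e n" if "n \<le> m" for n m
  proof -
    define w where "w t = (1/2) *\<^sub>R (v m t + v n t)" for t
    have wL: "w \<in> L2_controls"
      unfolding w_def[abs_def] by (intro L2_controls_scaleR L2_controls_add vL)
    have "norm (integral {0..t} w - U t) \<le> e n" if t: "t \<in> {0..1}" for t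
    proof -
      have "integral {0..t} w - U t = (1/2) *\<^sub>R (integral {0..t} (v m) - U t) + (1/2) *\<^sub>R (integral {0..t} (v n) - U t)"
        unfolding w_def using integrable_on_subinterval_unit(1)[OF vL, of 0 t] t
        by (simp add: integral_add scaleR_add_right algebra_simps scaleR_add_left[symmetric])
      also have "norm \<dots> \<le> (1/2) * norm (integral {0..t} (v m) - U t) + (1/2) * norm (integral {0..t} (v n) - U t)"
        by (rule order_trans[OF norm_triangle_ineq]) simp
      also have "\<dots> \<le> e n"
      proof -
        have "v m \<in> S n" using vS[of m] S_mono[OF \<open>n \<le> m\<close>] by blast
        then have "norm (integral {0..t} (v m) - U t) \<le> e n" "norm (integral {0..t} (v n) - U t) \<le> e n"
          using vS[of n] t by (simp_all add: S_def)
        then show ?thesis by simp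
      qed
      finally show ?thesis .
    qed
    then have "d n \<le> (L2_norm w)\<^sup>2" using wL by (intro d_le) (simp add: S_def)
    then have "4 * d n \<le> (L2_norm (\<lambda>t. v m t + v n t))\<^sup>2"
      unfolding w_def[abs_def] L2_norm_scaleR_square by (simp add: power2_eq_square)
    moreover note L2_norm_parallelogram[OF vL[of m] vL[of n]] v_lt[of m] v_lt[of n] D(2)[of m] e(2)[OF that]
    ultimately show ?thesis by linarith
  qed
  define q where "q k = (1/4::real)^k" for k
  have q: "q k > 0" for k by (simp add: q_def)
  have q_lim: "q \<longlonglongrightarrow> 0" unfolding q_def[abs_def] by (intro LIMSEQ_power_zero) simp
  have "(\<lambda>n. 2 * D - 2 * d n + 4 * e n) \<longlonglongrightarrow> 2 * D - 2 * D + 4 * 0"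
    by (intro tendsto_intros D(1) e_lim)
  then have lim0: "(\<lambda>n. 2 * D - 2 * d n + 4 * e n) \<longlonglongrightarrow> 0" by simp
  have "\<exists>N. \<forall>n\<ge>N. 2 * D - 2 * d n + 4 * e n < q k" for k
    using order_tendstoD(2)[OF lim0 q[of k]] unfolding eventually_sequentially .
  then obtain N where N: "\<And>k n. n \<ge> N k \<Longrightarrow> 2 * D - 2 * d n + 4 * e n < q k" by metis
  \<comment> \<open>Partial sums of \<open>N\<close> dominate \<open>N\<close> and are monotone, as
    \<open>close\<close> requires for consecutive indices.\<close>
  define \<rho> where "\<rho> k = (\<Sum>j\<le>k. N j)" for k
  have \<rho>: "\<rho> k \<ge> N k" "\<rho> k \<le> \<rho> (Suc k)" for k
    unfolding \<rho>_def by (auto intro!: member_le_sum)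
  have small: "2 * D - 2 * d (\<rho> k) + 4 * e (\<rho> k) < q k" for k using N[OF \<rho>(1)] .
  have e_small: "e (\<rho> k) \<le> q k" for k using small[of k] D(2)[of "\<rho> k"] e(1)[of "\<rho> k"] by linarith
  obtain w where w: "w \<in> L2_controls" "(L2_norm w)\<^sup>2 \<le> D + 0"
    and w_lim: "\<And>t. t \<in> {0..1} \<Longrightarrow> (\<lambda>k. integral {0..t} (v (\<rho> k))) \<longlonglongrightarrow> integral {0..t} w"
  proof (rule L2_series_limit[of "\<lambda>k. v (\<rho> k)" "\<lambda>k. D + q k" "D + 0"])
    show "(L2_norm (\<lambda>t. v (\<rho> (Suc k)) t - v (\<rho> k) t))\<^sup>2 \<le> (1/4)^k" for k
      using close[OF \<rho>(2)[of k]] small[of k] by (simp add: q_def)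
    show "(L2_norm (v (\<rho> k)))\<^sup>2 \<le> D + q k" for k
      using v_lt[of "\<rho> k"] D(2)[of "\<rho> k"] e_small[of k] by linarith
    show "(\<lambda>k. D + q k) \<longlonglongrightarrow> D + 0" by (intro tendsto_intros q_lim)
  qed (use vL in auto)
  \<comment> \<open>The primitives of \<open>v (\<rho> k)\<close> tend to \<open>U\<close> because
    \<open>v (\<rho> k)\<close> lies in \<open>S (\<rho> k)\<close>, and to the primitive of
    \<open>w\<close> by construction.\<close>
  have "integral {0..t} w = U t" if t: "t \<in> {0..1}" for t
  proof (rule LIMSEQ_unique[OF w_lim[OF t]])
    have "(\<lambda>k. integral {0..t} (v (\<rho> k)) - U t) \<longlonglongrightarrow> 0"
    proof (rule Lim_null_comparison[OF always_eventually q_lim], rule allI)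
      fix k show "norm (integral {0..t} (v (\<rho> k)) - U t) \<le> q k"
        using vS[of "\<rho> k"] t by (intro order_trans[OF _ e_small]) (simp add: S_def)
    qed
    then show "(\<lambda>k. integral {0..t} (v (\<rho> k))) \<longlonglongrightarrow> U t" by (simp add: LIM_zero_iff)
  qed
  then show ?thesis using w \<open>D \<le> c\<close> U by (intro that[OF r w(1)]) auto
qed

text \<open>Freezing the continuous factor on the cells of a fine grid trades the integral of the
  product for increments of the primitive of \<open>w\<close>.\<close>

lemma bilinear_integral_le_primitive:
  fixes h :: "'a::euclidean_space \<Rightarrow> 'b::euclidean_space \<Rightarrow> 'c::euclidean_space"
  assumes h: "bounded_bilinear h" and G: "continuous_on {0..1::real} G" and "e > 0"
  obtains K where "K \<ge> 0"
    "\<And>w \<delta> t. w absolutely_integrable_on {0..1} \<Longrightarrow>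
       \<forall>s\<in>{0..1}. norm (integral {0..s} w) \<le> \<delta> \<Longrightarrow> t \<in> {0..1} \<Longrightarrow>
       norm (integral {0..t} (\<lambda>s. h (G s) (w s))) \<le> K * \<delta> + e * integral {0..1} (\<lambda>s. norm (w s))"
proof -
  interpret h: bounded_bilinear h by (rule h)
  have bil: "bilinear h" using h by (simp add: bilinear_conv_bounded_bilinear)
  obtain P where P: "P > 0" "\<And>x y. norm (h x y) \<le> norm x * norm y * P"
    using h.pos_bounded by blast
  obtain B where B: "B > 0" "\<And>s. s \<in> {0..1} \<Longrightarrow> norm (G s) \<le> B"
    using compact_imp_bounded[OF compact_continuous_image[OF G compact_Icc]]
    unfolding bounded_pos by blast
  have "e / P > 0" using \<open>e > 0\<close> P(1) by simp
  moreover have "uniformly_continuous_on {0..1} G"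
    by (rule compact_uniformly_continuous[OF G compact_Icc])
  ultimately obtain \<eta> where \<eta>: "\<eta> > 0" "\<And>s r. s \<in> {0..1} \<Longrightarrow> r \<in> {0..1} \<Longrightarrow> dist r s < \<eta> \<Longrightarrow> dist (G r) (G s) < e / P"
    unfolding uniformly_continuous_on_def by blast
  obtain N :: nat where N: "N > 0" "1 / real N < \<eta>"
    using \<eta>(1) by (metis inverse_eq_divide ex_inverse_of_nat_less)
  show ?thesis
  proof (rule that[of "real N * (2 * B * P)"])
    show "0 \<le> real N * (2 * B * P)" using B P by simp
    fix w :: "real \<Rightarrow> 'b" and \<delta> t :: real
    assume w: "w absolutely_integrable_on {0..1::real}"
      and \<delta>': "\<forall>s\<in>{0..1}. norm (integral {0..s} w) \<le> \<delta>" and "t \<in> {0..1}"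
    have \<delta>: "norm (integral {0..s} w) \<le> \<delta>" if "s \<in> {0..1}" for s using \<delta>' that by blast
    have "\<delta> \<ge> 0" using \<delta>[of 0] by simp
    have hGw: "(\<lambda>s. h (G s) (w s)) absolutely_integrable_on {0..1}"
      by (rule absolutely_integrable_continuous_bilinear[OF bil G w])
    have iG: "(\<lambda>r. h (G r) (w r)) integrable_on {s..t}" and iw: "w integrable_on {s..t}"
      and inw: "(\<lambda>r. norm (w r)) integrable_on {s..t}" if "0 \<le> s" "t \<le> 1" for s t
      using hGw w that by (auto simp: absolutely_integrable_on_def intro!: integrable_on_subinterval[of _ "{0..1}"])
    have mono: "integral {0..s} (\<lambda>r. norm (w r)) \<le> integral {0..t} (\<lambda>r. norm (w r))"
      if "0 \<le> s" "s \<le> t" "t \<le> 1" for s t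
      using that by (intro integral_subset_le inw) auto
    \<comment> \<open>Induction over the number of cells needed to cover \<open>{0..t}\<close>; the
      last one may be cut off by \<open>t\<close>.\<close>
    have "norm (integral {0..t} (\<lambda>s. h (G s) (w s))) \<le> real i * (2 * B * P * \<delta>) + e * integral {0..t} (\<lambda>s. norm (w s))"
      if "t \<in> {0..1}" "t \<le> real i / real N" for i t
      using that
    proof (induction i arbitrary: t)
      case 0
      then show ?case by simp
    next
      case (Suc i)
      have BP: "0 \<le> 2 * B * P * \<delta>" using B P \<open>\<delta> \<ge> 0\<close> by simp
      show ?case
      proof (cases "t \<le> real i / real N")
        case True
        then show ?thesis using Suc.IH[OF Suc.prems(1) True] BP by (simp add: algebra_simps)
      next
        case False
        define s where "s = real i / real N"
        have s: "0 \<le> s" "s < t" "t \<le> 1" "t - s \<le> 1 / real N" "s \<in> {0..1}"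
          using False Suc.prems by (auto simp: s_def add_divide_distrib)
        have 0: "norm (integral {0..s} (\<lambda>s. h (G s) (w s))) \<le> real i * (2 * B * P * \<delta>) + e * integral {0..s} (\<lambda>s. norm (w s))"
          using Suc.IH[OF s(5)] by (simp add: s_def)
        have "integral {s..t} w = integral {0..t} w - integral {0..s} w"
          using Henstock_Kurzweil_Integration.integral_combine[of 0 s t w] iw s by (auto simp: algebra_simps)
        then have "norm (integral {s..t} w) \<le> 2 * \<delta>"
          using norm_triangle_ineq4[of "integral {0..t} w" "integral {0..s} w"] \<delta>[OF Suc.prems(1)] \<delta>[OF s(5)]
          by simp
        then have "norm (G s) * norm (integral {s..t} w) * P \<le> B * (2 * \<delta>) * P"
          using B(2)[OF s(5)] P(1) B(1) \<open>\<delta> \<ge> 0\<close> by (intro mult_mono) auto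
        then have 1: "norm (h (G s) (integral {s..t} w)) \<le> 2 * B * P * \<delta>"
          using P(2)[of "G s" "integral {s..t} w"] by (simp add: mult_ac)
        have lin: "((\<lambda>r. h (G s) (w r)) has_integral h (G s) (integral {s..t} w)) {s..t}"
          using has_integral_linear[OF integrable_integral[OF iw] h.bounded_linear_right] s by (simp add: o_def)
        \<comment> \<open>On a cell, \<open>G\<close> differs from its value at the left end by less
          than \<open>e / P\<close>, and the bound \<open>P\<close> of the bilinear map
          cancels.\<close>
        have 2: "norm (integral {s..t} (\<lambda>r. h (G r) (w r) - h (G s) (w r))) \<le> integral {s..t} (\<lambda>r. e * norm (w r))"
        proof (rule integral_norm_bound_integral)
          show "(\<lambda>r. h (G r) (w r) - h (G s) (w r)) integrable_on {s..t}"
            using lin s by (intro integrable_diff iG) auto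
          show "(\<lambda>r. e * norm (w r)) integrable_on {s..t}"
            using s by (intro integrable_on_mult_right inw) auto
          show "norm (h (G r) (w r) - h (G s) (w r)) \<le> e * norm (w r)" if "r \<in> {s..t}" for r
          proof -
            have "norm (G r - G s) < e / P"
              using \<eta>(2)[of s r] that s N(2) by (auto simp: dist_norm)
            have "norm (h (G r - G s) (w r)) \<le> norm (G r - G s) * norm (w r) * P" by (rule P(2))
            also have "\<dots> \<le> e / P * norm (w r) * P"
              using \<open>norm (G r - G s) < e / P\<close> P(1) by (intro mult_right_mono) auto
            finally show ?thesis using P(1) by (simp add: h.diff_left)
          qed
        qed
        have "integral {0..t} (\<lambda>r. h (G r) (w r)) = integral {0..s} (\<lambda>r. h (G r) (w r)) + integral {s..t} (\<lambda>r. h (G r) (w r))"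
          using Henstock_Kurzweil_Integration.integral_combine[of 0 s t "\<lambda>r. h (G r) (w r)"] iG s by auto
        also have "integral {s..t} (\<lambda>r. h (G r) (w r)) = integral {s..t} (\<lambda>r. h (G r) (w r) - h (G s) (w r)) + h (G s) (integral {s..t} w)"
          using integral_diff[OF iG has_integral_integrable[OF lin]] integral_unique[OF lin] s by simp
        finally have "norm (integral {0..t} (\<lambda>r. h (G r) (w r))) \<le> norm (integral {0..s} (\<lambda>r. h (G r) (w r)))
            + (norm (integral {s..t} (\<lambda>r. h (G r) (w r) - h (G s) (w r))) + norm (h (G s) (integral {s..t} w)))"
          by (simp only:) (intro norm_triangle_mono order_refl norm_triangle_ineq)
        also have "\<dots> \<le> (real i * (2 * B * P * \<delta>) + e * integral {0..s} (\<lambda>s. norm (w s)))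
            + (e * integral {s..t} (\<lambda>s. norm (w s)) + 2 * B * P * \<delta>)"
          using 0 1 2 by (intro add_mono) auto
        also have "\<dots> = real (Suc i) * (2 * B * P * \<delta>) + e * (integral {0..s} (\<lambda>s. norm (w s)) + integral {s..t} (\<lambda>s. norm (w s)))"
          by (simp add: algebra_simps)
        also have "integral {0..s} (\<lambda>s. norm (w s)) + integral {s..t} (\<lambda>s. norm (w s)) = integral {0..t} (\<lambda>s. norm (w s))"
          using Henstock_Kurzweil_Integration.integral_combine[of 0 s t "\<lambda>r. norm (w r)"] inw s by auto
        finally show ?thesis .
      qed
    qed
    from this[OF \<open>t \<in> {0..1}\<close>, of N]
    have "norm (integral {0..t} (\<lambda>s. h (G s) (w s))) \<le> real N * (2 * B * P * \<delta>) + e * integral {0..t} (\<lambda>s. norm (w s))"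
      using N \<open>t \<in> {0..1}\<close> by simp
    also have "\<dots> \<le> real N * (2 * B * P * \<delta>) + e * integral {0..1} (\<lambda>s. norm (w s))"
      using mono[of t 1] \<open>t \<in> {0..1}\<close> \<open>e > 0\<close> by (intro add_left_mono mult_left_mono) auto
    finally show "norm (integral {0..t} (\<lambda>s. h (G s) (w s))) \<le> real N * (2 * B * P) * \<delta> + e * integral {0..1} (\<lambda>s. norm (w s))"
      by (simp add: mult_ac)
  qed
qed

section \<open>Matrix products and null sets\<close>

lemma bilinear_matrix_vector_mult: "bilinear ((*v) :: real^'k^'n \<Rightarrow> _)"
  by (auto simp: bilinear_def linear_iff matrix_vector_mult_add_rdistrib matrix_vector_right_distrib
      scaleR_matrix_vector_assoc matrix_vector_mult_scaleR)

lemma negligible_if_AE_lebesgue_on: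
  assumes "AE t in lebesgue_on S. P t" "S \<in> sets lebesgue"
  obtains N where "negligible N" "\<And>t. t \<in> S - N \<Longrightarrow> P t"
proof -
  obtain N where N: "N \<in> null_sets (lebesgue_on S)" "{t \<in> space (lebesgue_on S). \<not> P t} \<subseteq> N"
    using assms(1) unfolding eventually_ae_filter by blast
  then have "negligible N"
    using null_sets_restrict_space[OF assms(2)] by (auto simp: negligible_iff_null_sets)
  with N(2) show ?thesis by (intro that[of N]) auto
qed

lemma AE_lebesgue_on_if_negligible:
  assumes "negligible N" "S \<in> sets lebesgue" "\<And>t. t \<in> S - N \<Longrightarrow> P t"
  shows "AE t in lebesgue_on S. P t"
proof (rule AE_I'[of "N \<inter> S"])
  show "N \<inter> S \<in> null_sets (lebesgue_on S)"
    using assms(1,2) negligible_Int by (auto simp: null_sets_restrict_space negligible_iff_null_sets[symmetric])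
qed (use assms(3) in auto)

section \<open>Trajectories\<close>

locale control_system =
  fixes \<Theta> :: "'p::euclidean_space set"
    and F0 :: "real^'n \<Rightarrow> 'p \<Rightarrow> real^'n"
    and F :: "real^'n \<Rightarrow> 'p \<Rightarrow> real^'k^'n"
    and x0 :: "'p \<Rightarrow> real^'n"
    and L :: real
  assumes compact_\<Theta>: "compact \<Theta>"
    and L_pos: "L > 0"
    and F0_lipschitz: "\<And>x y \<theta> \<theta>'. \<theta> \<in> \<Theta> \<Longrightarrow> \<theta>' \<in> \<Theta> \<Longrightarrow>
           norm (F0 x \<theta> - F0 y \<theta>') \<le> L * (norm (x - y) + norm (\<theta> - \<theta>'))"
    and F_lipschitz: "\<And>i x y \<theta> \<theta>'. \<theta> \<in> \<Theta> \<Longrightarrow> \<theta>' \<in> \<Theta> \<Longrightarrow>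
           norm (column i (F x \<theta>) - column i (F y \<theta>')) \<le> L * (norm (x - y) + norm (\<theta> - \<theta>'))"
    and x0_continuous: "continuous_on \<Theta> x0"
begin

section \<open>The controlled vector field\<close>

definition field :: "real^'n \<Rightarrow> 'p \<Rightarrow> real^'k \<Rightarrow> real^'n" where
  "field x \<theta> w = F0 x \<theta> + F x \<theta> *v w"

text \<open>One \<open>L\<close> for the drift and one for each column, as every component of
  \<open>w\<close> is at most \<open>norm w\<close>. Then \<open>K * (1 + norm w)\<close> is a
  Lipschitz constant of \<open>field\<close> in state and parameter jointly.\<close>

definition K :: real where "K = L * (1 + real CARD('k))"

lemma K_pos: "K > 0"
  unfolding K_def using L_pos by (intro mult_pos_pos) auto

lemma field_lipschitz:
  assumes "\<theta> \<in> \<Theta>" "\<theta>' \<in> \<Theta>"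
  shows "norm (field x \<theta> w - field y \<theta>' w) \<le> K * (1 + norm w) * (norm (x - y) + norm (\<theta> - \<theta>'))"
proof -
  define d where "d = norm (x - y) + norm (\<theta> - \<theta>')"
  have d: "d \<ge> 0" by (simp add: d_def)
  have "F x \<theta> *v w - F y \<theta>' *v w = (\<Sum>i\<in>UNIV. (w $ i) *s (column i (F x \<theta>) - column i (F y \<theta>')))"
    by (simp add: matrix_mult_sum sum_subtractf vector_ssub_ldistrib)
  also have "norm \<dots> \<le> (\<Sum>i\<in>UNIV. norm ((w $ i) *s (column i (F x \<theta>) - column i (F y \<theta>'))))"
    by (rule norm_sum)
  also have "\<dots> \<le> (\<Sum>i\<in>(UNIV::'k set). norm w * (L * d))"
    using F_lipschitz[OF assms] component_le_norm_cart[of w]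
    by (intro sum_mono) (auto simp: scalar_mult_eq_scaleR d_def intro!: mult_mono)
  also have "\<dots> = real CARD('k) * norm w * L * d" by simp
  finally have "norm (F x \<theta> *v w - F y \<theta>' *v w) \<le> real CARD('k) * norm w * L * d" .
  moreover have "norm (F0 x \<theta> - F0 y \<theta>') \<le> L * d" using F0_lipschitz[OF assms] by (simp add: d_def)
  moreover have eq: "field x \<theta> w - field y \<theta>' w = (F0 x \<theta> - F0 y \<theta>') + (F x \<theta> *v w - F y \<theta>' *v w)"
    by (simp add: field_def)
  ultimately have "norm (field x \<theta> w - field y \<theta>' w) \<le> L * d + real CARD('k) * norm w * L * d"
    using norm_triangle_ineq[of "F0 x \<theta> - F0 y \<theta>'" "F x \<theta> *v w - F y \<theta>' *v w"] unfolding eq by linarith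
  also have "\<dots> \<le> K * (1 + norm w) * d"
  proof -
    have "0 \<le> L * norm w * d + L * real CARD('k) * d" using d L_pos by simp
    then show ?thesis unfolding K_def by (simp add: algebra_simps)
  qed
  finally show ?thesis by (simp add: d_def)
qed

lemma F0_continuous: "\<theta> \<in> \<Theta> \<Longrightarrow> continuous_on UNIV (\<lambda>x. F0 x \<theta>)"
  using F0_lipschitz[of \<theta> \<theta>] L_pos
  by (intro lipschitz_on_continuous_on[of L] lipschitz_onI) (auto simp: dist_norm)

lemma F_continuous:
  assumes "\<theta> \<in> \<Theta>"
  shows "continuous_on UNIV (\<lambda>x. F x \<theta>)"
proof -
  have "continuous_on UNIV (\<lambda>x. column j (F x \<theta>))" for j
    using F_lipschitz[OF assms assms] L_pos
    by (intro lipschitz_on_continuous_on[of L] lipschitz_onI) (auto simp: dist_norm)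
  then have "continuous_on UNIV (\<lambda>x. \<chi> i j. column j (F x \<theta>) $ i)"
    by (intro continuous_on_vec_lambda continuous_on_component)
  then show ?thesis by (simp add: column_def)
qed

lemma field_integrable:
  assumes "\<theta> \<in> \<Theta>" and x: "continuous_on {0..1} x" and u: "u \<in> L2_controls"
  shows "(\<lambda>s. field (x s) \<theta> (u s)) absolutely_integrable_on {0..1}"
  unfolding field_def
proof (intro set_integral_add(1))
  have "continuous_on {0..1} (\<lambda>s. F0 (x s) \<theta>)"
    using continuous_on_compose2[OF F0_continuous[OF assms(1)] x] by simp
  then show "(\<lambda>s. F0 (x s) \<theta>) absolutely_integrable_on {0..1}"
    by (rule absolutely_integrable_continuous_real)
  have "continuous_on {0..1} (\<lambda>s. F (x s) \<theta>)"
    using continuous_on_compose2[OF F_continuous[OF assms(1)] x] by simp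
  then show "(\<lambda>s. F (x s) \<theta> *v u s) absolutely_integrable_on {0..1}"
    by (rule absolutely_integrable_continuous_bilinear[OF bilinear_matrix_vector_mult _ L2_controls_integrable(3)[OF u]])
qed

lemma rate_integrable: "u \<in> L2_controls \<Longrightarrow> (\<lambda>s. K * (1 + norm (u s))) integrable_on {0..1}"
  using integrable_on_subinterval_unit(2)[of u 0 1]
  by (intro integrable_on_mult_right integrable_add integrable_const_ivl) auto

text \<open>The \<open>2\<close> collects \<open>t \<le> 1\<close> and the first term of
  \<open>L2_controls_integral_norm_le\<close> with \<open>\<kappa> = 1\<close>. The integrated rate
  is the Gronwall exponent; bounding it by the norm alone makes stability uniform over bounded sets
  of controls.\<close>

lemma integral_rate_le:
  assumes u: "u \<in> L2_controls" and t: "t \<in> {0..1}"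
  shows "integral {0..t} (\<lambda>s. K * (1 + norm (u s))) \<le> K * (2 + (L2_norm u)\<^sup>2)"
proof -
  have "integral {0..t} (\<lambda>s. 1 + norm (u s)) = t + integral {0..t} (\<lambda>s. norm (u s))"
    using t integrable_on_subinterval_unit(2)[OF u, of 0 t] by (subst integral_add) auto
  then have "integral {0..t} (\<lambda>s. K * (1 + norm (u s))) = K * (t + integral {0..t} (\<lambda>s. norm (u s)))"
    by simp
  also have "\<dots> \<le> K * (2 + (L2_norm u)\<^sup>2)"
    using t K_pos L2_controls_integral_norm_le[OF u, of 1 0 t] by (intro mult_left_mono) auto
  finally show ?thesis .
qed

text \<open>The two directions are the two halves of the fundamental theorem for absolutely
  continuous functions. On the right only continuity of \<open>x\<close> is asked for, so uniform
  limits and Gronwall estimates apply directly.\<close>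

lemma is_trajectory_iff_integral:
  assumes "\<theta> \<in> \<Theta>" and u: "u \<in> L2_controls"
  shows "is_trajectory F0 F x0 u \<theta> x \<longleftrightarrow> continuous_on {0..1} x \<and>
    (\<forall>t\<in>{0..1}. x t = x0 \<theta> + integral {0..t} (\<lambda>s. field (x s) \<theta> (u s)))"
proof (intro iffI conjI ballI; (elim conjE)?)
  assume "is_trajectory F0 F x0 u \<theta> x"
  then have ac: "absolutely_continuous_on_interval 0 1 x" and init: "x 0 = x0 \<theta>"
    and der: "AE t in lebesgue_on {0..1}. (x has_vector_derivative field (x t) \<theta> (u t)) (at t within {0..1})"
    by (auto simp: is_trajectory_def field_def)
  show "continuous_on {0..1} x"
    by (rule absolutely_continuous_on_interval_imp_continuous_on[OF ac])
  fix t :: real assume t: "t \<in> {0..1}"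
  obtain N where N: "negligible N"
    "\<And>t. t \<in> {0..1} - N \<Longrightarrow> (x has_vector_derivative field (x t) \<theta> (u t)) (at t within {0..1})"
    using negligible_if_AE_lebesgue_on[OF der] by auto
  have "((\<lambda>s. field (x s) \<theta> (u s)) has_integral (x t - x 0)) {0..t}"
  proof (rule fundamental_theorem_of_calculus_absolutely_continuous[OF _ _ N(1)])
    show "absolutely_continuous_on_interval 0 t x"
      using absolutely_continuous_on_interval_subinterval[OF ac] t by auto
    show "(x has_vector_derivative field (x s) \<theta> (u s)) (at s within {0..t})" if "s \<in> {0..t} - N" for s
      using that t by (intro has_vector_derivative_within_subset[OF N(2)]) auto
  qed (use t in auto)
  then show "x t = x0 \<theta> + integral {0..t} (\<lambda>s. field (x s) \<theta> (u s))"
    using init by (simp add: integral_unique)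
next
  assume x: "continuous_on {0..1} x"
    and eq: "\<forall>t\<in>{0..1}. x t = x0 \<theta> + integral {0..t} (\<lambda>s. field (x s) \<theta> (u s))"
  have int: "(\<lambda>s. field (x s) \<theta> (u s)) absolutely_integrable_on {0..1}"
    by (rule field_integrable[OF assms(1) x u])
  obtain N where N: "negligible N"
    "\<And>t. t \<in> {0..1} - N \<Longrightarrow> ((\<lambda>t. integral {0..t} (\<lambda>s. field (x s) \<theta> (u s))) has_vector_derivative
       field (x t) \<theta> (u t)) (at t within {0..1})"
    using has_vector_derivative_indefinite_integral_AE[OF set_lebesgue_integral_eq_integral(1)[OF int]]
    by blast
  have "absolutely_continuous_on_interval 0 1 x"
    using eq by (intro absolutely_continuous_on_interval_dominated[OF
        absolutely_continuous_indefinite_integral[OF int], of 1]) auto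
  moreover have "AE t in lebesgue_on {0..1}. (x has_vector_derivative field (x t) \<theta> (u t)) (at t within {0..1})"
  proof (rule AE_lebesgue_on_if_negligible[OF N(1)])
    fix t assume t: "t \<in> {0..1} - N"
    have "((\<lambda>t. x0 \<theta> + integral {0..t} (\<lambda>s. field (x s) \<theta> (u s))) has_vector_derivative
       0 + field (x t) \<theta> (u t)) (at t within {0..1})"
      by (intro has_vector_derivative_add has_vector_derivative_const N(2) t)
    \<comment> \<open>The equation for \<open>x\<close> holds on \<open>{0..1}\<close> only, which
      suffices for a derivative within that interval.\<close>
    then show "(x has_vector_derivative field (x t) \<theta> (u t)) (at t within {0..1})"
      using eq t by (intro has_vector_derivative_transform[of t "{0..1}" x]) auto
  qed simp
  moreover have "x 0 = x0 \<theta>" using eq by simp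
  ultimately show "is_trajectory F0 F x0 u \<theta> x" by (simp add: is_trajectory_def field_def)
qed

text \<open>The perturbation \<open>\<rho>\<close> absorbs a change of the parameter or of the control.\<close>

lemma integral_equation_stability:
  assumes "\<theta> \<in> \<Theta>" and u: "u \<in> L2_controls" and "A \<ge> 0"
    and x: "continuous_on {0..1} x" and y: "continuous_on {0..1} y"
    and eq: "\<And>t. t \<in> {0..1} \<Longrightarrow> x t - y t =
      \<rho> t + (integral {0..t} (\<lambda>s. field (x s) \<theta> (u s)) - integral {0..t} (\<lambda>s. field (y s) \<theta> (u s)))"
    and \<rho>: "\<And>t. t \<in> {0..1} \<Longrightarrow> norm (\<rho> t) \<le> A"
    and t: "t \<in> {0..1}"
  shows "norm (x t - y t) \<le> 2 * A * exp (2 * (K * (2 + (L2_norm u)\<^sup>2)))"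
proof -
  have rate_nonneg: "0 \<le> K * (1 + norm (u s))" for s using K_pos by simp
  have "norm (x t - y t) \<le> 2 * A * exp (2 * integral {0..t} (\<lambda>s. K * (1 + norm (u s))))"
  proof (rule gronwall_integral[where v = "\<lambda>t. norm (x t - y t)", OF rate_integrable[OF u] rate_nonneg _ _ \<open>A \<ge> 0\<close> _ t])
    show "continuous_on {0..1} (\<lambda>t. norm (x t - y t))" by (intro continuous_intros x y)
    fix t :: real assume t: "t \<in> {0..1}"
    have ix: "(\<lambda>s. field (x s) \<theta> (u s)) integrable_on {0..t}" and iy: "(\<lambda>s. field (y s) \<theta> (u s)) integrable_on {0..t}"
      using field_integrable[OF assms(1) x u] field_integrable[OF assms(1) y u] t
      by (auto simp: absolutely_integrable_on_def intro!: integrable_on_subinterval[of _ "{0..1}"])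
    have "norm (integral {0..t} (\<lambda>s. field (x s) \<theta> (u s) - field (y s) \<theta> (u s)))
        \<le> integral {0..t} (\<lambda>s. K * (1 + norm (u s)) * norm (x s - y s))"
      using field_lipschitz[OF assms(1) assms(1)]
      by (intro integral_norm_bound_integral integrable_diff ix iy
          integrable_mult_norm_diff[OF rate_integrable[OF u] rate_nonneg x y t]) simp
    then show "norm (x t - y t) \<le> A + integral {0..t} (\<lambda>s. K * (1 + norm (u s)) * norm (x s - y s))"
      unfolding eq[OF t] integral_diff[OF ix iy, symmetric]
      using \<rho>[OF t] norm_triangle_ineq[of "\<rho> t"] by (meson add_mono order_trans)
  qed simp
  also have "\<dots> \<le> 2 * A * exp (2 * (K * (2 + (L2_norm u)\<^sup>2)))"
    using integral_rate_le[OF u t] \<open>A \<ge> 0\<close> by (intro mult_left_mono) auto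
  finally show ?thesis .
qed

text \<open>Shows that the definite description in \<open>trajectory\<close> denotes a solution.
  Picard iteration provides one, made extensional by restriction; two solutions agree by the
  stability estimate with perturbation \<open>0\<close> and \<open>A = 0\<close>.\<close>

lemma trajectory_integral_equation:
  assumes "\<theta> \<in> \<Theta>" and u: "u \<in> L2_controls"
  shows "continuous_on {0..1} (trajectory F0 F x0 u \<theta>)"
    and "\<And>t. t \<in> {0..1} \<Longrightarrow> trajectory F0 F x0 u \<theta> t =
      x0 \<theta> + integral {0..t} (\<lambda>s. field (trajectory F0 F x0 u \<theta> s) \<theta> (u s))"
proof -
  obtain y where y: "continuous_on {0..1} y"
    "\<And>t. t \<in> {0..1} \<Longrightarrow> y t = x0 \<theta> + integral {0..t} (\<lambda>s. field (y s) \<theta> (u s))"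
  proof (rule caratheodory_existence[of "\<lambda>s. K * (1 + norm (u s))" 0 1 "\<lambda>s x. field x \<theta> (u s)" "x0 \<theta>"])
    show "(\<lambda>s. field (y s) \<theta> (u s)) integrable_on {0..1}" if "continuous_on {0..1} y" for y
      using field_integrable[OF assms(1) that u] by (simp add: absolutely_integrable_on_def)
    show "norm (field x \<theta> (u s) - field y \<theta> (u s)) \<le> K * (1 + norm (u s)) * norm (x - y)" for s x y
      using field_lipschitz[OF assms(1) assms(1), of x "u s" y] by simp
  qed (use rate_integrable[OF u] K_pos in auto)
  define x where "x = restrict y {0..1}"
  have xy: "x t = y t" if "t \<in> {0..1}" for t using that by (simp add: x_def)
  have "x t = x0 \<theta> + integral {0..t} (\<lambda>s. field (x s) \<theta> (u s))" if "t \<in> {0..1}" for t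
  proof -
    have "integral {0..t} (\<lambda>s. field (x s) \<theta> (u s)) = integral {0..t} (\<lambda>s. field (y s) \<theta> (u s))"
      using that by (intro integral_cong) (auto simp: x_def)
    then show ?thesis using y(2)[OF that] xy[OF that] by simp
  qed
  moreover have "continuous_on {0..1} x"
    using y(1) by (rule continuous_on_eq) (simp add: x_def)
  ultimately have x: "x \<in> extensional {0..1} \<and> is_trajectory F0 F x0 u \<theta> x"
    by (simp add: is_trajectory_iff_integral[OF assms] x_def)
  have uniq: "z = x" if z: "z \<in> extensional {0..1} \<and> is_trajectory F0 F x0 u \<theta> z" for z
  proof (rule extensionalityI[of _ "{0..1}"])
    fix t :: real assume t: "t \<in> {0..1}"
    have "norm (z t - x t) \<le> 2 * 0 * exp (2 * (K * (2 + (L2_norm u)\<^sup>2)))"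
      using x z is_trajectory_iff_integral[OF assms]
      by (intro integral_equation_stability[OF assms, where \<rho> = "\<lambda>_. 0"] t) auto
    then show "z t = x t" by simp
  qed (use x z in auto)
  have "trajectory F0 F x0 u \<theta> = x"
    unfolding trajectory_def using x uniq by (rule the_equality)
  then show "continuous_on {0..1} (trajectory F0 F x0 u \<theta>)"
    "\<And>t. t \<in> {0..1} \<Longrightarrow> trajectory F0 F x0 u \<theta> t =
      x0 \<theta> + integral {0..t} (\<lambda>s. field (trajectory F0 F x0 u \<theta> s) \<theta> (u s))"
    using x is_trajectory_iff_integral[OF assms] by auto
qed

end

section \<open>Stability and optimality\<close>

lemma (in finite_measure) bounded_convergence:
  fixes g :: "nat \<Rightarrow> 'a \<Rightarrow> real"
  assumes "\<And>n. g n \<in> borel_measurable M" "\<And>n x. x \<in> space M \<Longrightarrow> \<bar>g n x\<bar> \<le> B"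
    and "\<And>x. x \<in> space M \<Longrightarrow> (\<lambda>n. g n x) \<longlonglongrightarrow> f x"
  shows "(\<lambda>n. integral\<^sup>L M (g n)) \<longlonglongrightarrow> integral\<^sup>L M f"
proof (rule integral_dominated_convergence[where w = "\<lambda>_. B"])
  show "f \<in> borel_measurable M"
    by (rule borel_measurable_LIMSEQ_metric[OF assms(1,3)])
qed (use assms in auto)

lemma borel_measurable_continuous_on_sets_eq:
  assumes "sets M = sets (restrict_space borel S)" "continuous_on S f"
  shows "f \<in> borel_measurable M"
  using borel_measurable_continuous_on_restrict[OF assms(2)] measurable_cong_sets[OF assms(1) refl] by blast

section \<open>Dependence of trajectories on parameter and control\<close>

context control_system
begin

text \<open>At a single reference parameter the growth in \<open>w\<close> is linear, and
  compactness keeps all other parameters at bounded distance from it. The bound is written as a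
  multiple of the rate \<open>K * (1 + norm w)\<close> so that \<open>integral_rate_le\<close> can
  integrate it.\<close>

lemma field_growth:
  obtains B where "B \<ge> 0" "\<And>\<theta> w. \<theta> \<in> \<Theta> \<Longrightarrow> norm (field 0 \<theta> w) \<le> B * (K * (1 + norm w))"
proof (cases "\<Theta> = {}")
  case True
  then show ?thesis by (intro that[of 0]) auto
next
  case False
  then obtain \<theta>0 where \<theta>0: "\<theta>0 \<in> \<Theta>" by blast
  obtain M where M: "M > 0" "\<And>\<theta>. \<theta> \<in> \<Theta> \<Longrightarrow> norm \<theta> \<le> M"
    using compact_imp_bounded[OF compact_\<Theta>] unfolding bounded_pos by blast
  obtain P where P: "P > 0" "\<And>w. norm (F 0 \<theta>0 *v w) \<le> norm w * P"
    using bounded_linear.pos_bounded[OF matrix_vector_mul_bounded_linear[of "F 0 \<theta>0"]] by blast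
  \<comment> \<open>The division cancels the factor \<open>K\<close> of the rate;
    \<open>2 * M\<close> bounds \<open>norm (\<theta> - \<theta>0)\<close>.\<close>
  define B where "B = (norm (F0 0 \<theta>0) + P) / K + 2 * M"
  show ?thesis
  proof (rule that[of B])
    show "B \<ge> 0" using M P K_pos by (simp add: B_def)
    fix \<theta> w assume \<theta>: "\<theta> \<in> \<Theta>"
    have "norm (field 0 \<theta>0 w) \<le> norm (F0 0 \<theta>0) + norm w * P"
      unfolding field_def using norm_triangle_ineq[of "F0 0 \<theta>0" "F 0 \<theta>0 *v w"] P(2)[of w] by linarith
    also have "\<dots> \<le> (norm (F0 0 \<theta>0) + P) * (1 + norm w)"
      using P(1) by (simp add: algebra_simps)
    finally have 1: "norm (field 0 \<theta>0 w) \<le> (norm (F0 0 \<theta>0) + P) * (1 + norm w)" .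
    have "norm (field 0 \<theta> w - field 0 \<theta>0 w) \<le> K * (1 + norm w) * norm (\<theta> - \<theta>0)"
      using field_lipschitz[OF \<theta> \<theta>0, of 0 w 0] by simp
    also have "\<dots> \<le> K * (1 + norm w) * (2 * M)"
      using K_pos M(2)[OF \<theta>] M(2)[OF \<theta>0] norm_triangle_ineq4[of \<theta> \<theta>0] by (intro mult_left_mono) auto
    finally have 2: "norm (field 0 \<theta> w - field 0 \<theta>0 w) \<le> K * (1 + norm w) * (2 * M)" .
    have "norm (field 0 \<theta> w) \<le> (norm (F0 0 \<theta>0) + P) * (1 + norm w) + K * (1 + norm w) * (2 * M)"
      using norm_triangle_sub[of "field 0 \<theta> w" "field 0 \<theta>0 w"] 1 2 by linarith
    also have "\<dots> = B * (K * (1 + norm w))"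
      using K_pos by (simp add: B_def field_simps)
    finally show "norm (field 0 \<theta> w) \<le> B * (K * (1 + norm w))" .
  qed
qed

text \<open>The trajectory is compared with the zero function, which satisfies its equation up to a
  perturbation made of the initial value and the integrated field at the origin. The bound depends
  on the control only through \<open>C\<close>.\<close>

lemma trajectory_bounded:
  obtains R where "\<And>u \<theta> t. u \<in> L2_controls \<Longrightarrow> (L2_norm u)\<^sup>2 \<le> C \<Longrightarrow> \<theta> \<in> \<Theta> \<Longrightarrow> t \<in> {0..1} \<Longrightarrow>
    norm (trajectory F0 F x0 u \<theta> t) \<le> R"
proof -
  obtain X where X: "X > 0" "\<And>\<theta>. \<theta> \<in> \<Theta> \<Longrightarrow> norm (x0 \<theta>) \<le> X"
    using compact_imp_bounded[OF compact_continuous_image[OF x0_continuous compact_\<Theta>]]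
    unfolding bounded_pos by blast
  obtain B where B: "B \<ge> 0" "\<And>\<theta> w. \<theta> \<in> \<Theta> \<Longrightarrow> norm (field 0 \<theta> w) \<le> B * (K * (1 + norm w))"
    by (rule field_growth) (rule that)
  define A where "A = X + B * (K * (2 + C))"
  show ?thesis
  proof (rule that[of "2 * A * exp (2 * (K * (2 + C)))"])
    fix u :: "real \<Rightarrow> real^'k" and \<theta> t
    assume u: "u \<in> L2_controls" "(L2_norm u)\<^sup>2 \<le> C" and \<theta>: "\<theta> \<in> \<Theta>" and t: "t \<in> {0..1::real}"
    note x = trajectory_integral_equation[OF \<theta> u(1)]
    have C0: "C \<ge> 0" using u(2) by (rule order_trans[OF zero_le_power2])
    then have A0: "A \<ge> 0" using X B(1) K_pos by (simp add: A_def)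
    define \<rho> where "\<rho> s = x0 \<theta> + integral {0..s} (\<lambda>s. field 0 \<theta> (u s))" for s
    have "norm (trajectory F0 F x0 u \<theta> t - 0) \<le> 2 * A * exp (2 * (K * (2 + (L2_norm u)\<^sup>2)))"
    proof (rule integral_equation_stability[OF \<theta> u(1) A0 x(1) _ _ _ t, where \<rho> = \<rho> and y = "\<lambda>_. 0"])
      fix s :: real assume s: "s \<in> {0..1}"
      show "trajectory F0 F x0 u \<theta> s - 0 = \<rho> s + (integral {0..s} (\<lambda>s. field (trajectory F0 F x0 u \<theta> s) \<theta> (u s))
          - integral {0..s} (\<lambda>s. field 0 \<theta> (u s)))"
        using x(2)[OF s] by (simp add: \<rho>_def)
      have "norm (integral {0..s} (\<lambda>s. field 0 \<theta> (u s))) \<le> integral {0..s} (\<lambda>s. B * (K * (1 + norm (u s))))"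
      proof (rule integral_norm_bound_integral)
        show "(\<lambda>s. field 0 \<theta> (u s)) integrable_on {0..s}"
          using field_integrable[OF \<theta> _ u(1), of "\<lambda>_. 0"] s
          by (auto simp: absolutely_integrable_on_def intro!: integrable_on_subinterval[of _ "{0..1}"])
        show "(\<lambda>s. B * (K * (1 + norm (u s)))) integrable_on {0..s}"
          by (rule integrable_on_mult_right[OF integrable_on_subinterval[OF rate_integrable[OF u(1)]]]) (use s in auto)
      qed (rule B(2)[OF \<theta>])
      also have "\<dots> = B * integral {0..s} (\<lambda>s. K * (1 + norm (u s)))" by (rule integral_mult_right)
      also have "\<dots> \<le> B * (K * (2 + (L2_norm u)\<^sup>2))"
        using B(1) by (intro mult_left_mono integral_rate_le u s)
      also have "\<dots> \<le> B * (K * (2 + C))"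
        using B(1) K_pos u(2) by (intro mult_left_mono) auto
      finally show "norm (\<rho> s) \<le> A"
        using norm_triangle_ineq[of "x0 \<theta>" "integral {0..s} (\<lambda>s. field 0 \<theta> (u s))"] X(2)[OF \<theta>]
        unfolding \<rho>_def A_def by linarith
    qed simp
    also have "\<dots> \<le> 2 * A * exp (2 * (K * (2 + C)))"
      using A0 K_pos u(2) by (intro mult_left_mono) auto
    finally show "norm (trajectory F0 F x0 u \<theta> t) \<le> 2 * A * exp (2 * (K * (2 + C)))" by simp
  qed
qed

text \<open>The perturbation gathers the difference of the initial values and the effect of
  exchanging the parameter in the field along the second trajectory \<open>y\<close>; the two curves
  are then compared under the same \<open>\<theta>\<close>.\<close>

lemma trajectory_dist_parameters:
  assumes \<theta>: "\<theta> \<in> \<Theta>" "\<theta>' \<in> \<Theta>" and u: "u \<in> L2_controls" and t: "t \<in> {0..1}"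
  shows "norm (trajectory F0 F x0 u \<theta> t - trajectory F0 F x0 u \<theta>' t) \<le>
    2 * (norm (x0 \<theta> - x0 \<theta>') + K * (2 + (L2_norm u)\<^sup>2) * norm (\<theta> - \<theta>')) * exp (2 * (K * (2 + (L2_norm u)\<^sup>2)))"
proof -
  define x where "x = trajectory F0 F x0 u \<theta>"
  define y where "y = trajectory F0 F x0 u \<theta>'"
  note x = trajectory_integral_equation[OF \<theta>(1) u, folded x_def]
  note y = trajectory_integral_equation[OF \<theta>(2) u, folded y_def]
  define \<rho> where "\<rho> s = x0 \<theta> - x0 \<theta>' + (integral {0..s} (\<lambda>s. field (y s) \<theta> (u s)) - integral {0..s} (\<lambda>s. field (y s) \<theta>' (u s)))" for s
  have "norm (x t - y t) \<le>
    2 * (norm (x0 \<theta> - x0 \<theta>') + K * (2 + (L2_norm u)\<^sup>2) * norm (\<theta> - \<theta>')) * exp (2 * (K * (2 + (L2_norm u)\<^sup>2)))"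
  proof (rule integral_equation_stability[OF \<theta>(1) u _ x(1) y(1) _ _ t, where \<rho> = \<rho>])
    show "0 \<le> norm (x0 \<theta> - x0 \<theta>') + K * (2 + (L2_norm u)\<^sup>2) * norm (\<theta> - \<theta>')"
      using K_pos by (intro add_nonneg_nonneg mult_nonneg_nonneg) auto
    fix s :: real assume s: "s \<in> {0..1}"
    show "x s - y s = \<rho> s + (integral {0..s} (\<lambda>s. field (x s) \<theta> (u s)) - integral {0..s} (\<lambda>s. field (y s) \<theta> (u s)))"
      unfolding x(2)[OF s] y(2)[OF s] \<rho>_def by simp
    have i: "(\<lambda>r. field (y r) \<theta>'' (u r)) integrable_on {0..s}" if "\<theta>'' \<in> \<Theta>" for \<theta>''
      using field_integrable[OF that y(1) u] s
      by (auto simp: absolutely_integrable_on_def intro!: integrable_on_subinterval[of _ "{0..1}"])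
    have "norm (integral {0..s} (\<lambda>s. field (y s) \<theta> (u s)) - integral {0..s} (\<lambda>s. field (y s) \<theta>' (u s)))
        \<le> integral {0..s} (\<lambda>s. K * (1 + norm (u s)) * norm (\<theta> - \<theta>'))"
      unfolding integral_diff[OF i[OF \<theta>(1)] i[OF \<theta>(2)], symmetric]
    proof (rule integral_norm_bound_integral)
      show "(\<lambda>s. K * (1 + norm (u s)) * norm (\<theta> - \<theta>')) integrable_on {0..s}"
        using integrable_on_subinterval[OF rate_integrable[OF u], of 0 s] s
        by (intro integrable_on_mult_left) auto
      show "norm (field (y r) \<theta> (u r) - field (y r) \<theta>' (u r)) \<le> K * (1 + norm (u r)) * norm (\<theta> - \<theta>')" for r
        using field_lipschitz[OF \<theta>, of "y r" "u r" "y r"] by simp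
    qed (intro integrable_diff i \<theta>)
    also have "\<dots> = integral {0..s} (\<lambda>s. K * (1 + norm (u s))) * norm (\<theta> - \<theta>')" by (rule integral_mult_left)
    also have "\<dots> \<le> K * (2 + (L2_norm u)\<^sup>2) * norm (\<theta> - \<theta>')"
      by (intro mult_right_mono integral_rate_le u s) simp
    finally show "norm (\<rho> s) \<le> norm (x0 \<theta> - x0 \<theta>') + K * (2 + (L2_norm u)\<^sup>2) * norm (\<theta> - \<theta>')"
      unfolding \<rho>_def by (intro norm_triangle_mono order_refl)
  qed
  then show ?thesis by (simp add: x_def y_def)
qed

text \<open>Needed for the measurability of the cost as a function of the parameter.\<close>

lemma trajectory_continuous_parameter:
  assumes u: "u \<in> L2_controls" and t: "t \<in> {0..1}"
  shows "continuous_on \<Theta> (\<lambda>\<theta>. trajectory F0 F x0 u \<theta> t)"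
  unfolding continuous_on_sequentially o_def
proof (intro allI ballI impI, elim conjE)
  fix \<eta> :: "nat \<Rightarrow> 'p" and \<theta>
  assume \<theta>: "\<theta> \<in> \<Theta>" and \<eta>: "\<forall>n. \<eta> n \<in> \<Theta>" "\<eta> \<longlonglongrightarrow> \<theta>"
  define M where "M = K * (2 + (L2_norm u)\<^sup>2)"
  have x0_lim: "(\<lambda>n. x0 (\<eta> n)) \<longlonglongrightarrow> x0 \<theta>"
    using x0_continuous \<theta> \<eta> unfolding continuous_on_sequentially o_def by blast
  have "(\<lambda>n. trajectory F0 F x0 u (\<eta> n) t - trajectory F0 F x0 u \<theta> t) \<longlonglongrightarrow> 0"
  proof (rule Lim_null_comparison)
    show "\<forall>\<^sub>F n in sequentially. norm (trajectory F0 F x0 u (\<eta> n) t - trajectory F0 F x0 u \<theta> t)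
      \<le> 2 * (norm (x0 (\<eta> n) - x0 \<theta>) + M * norm (\<eta> n - \<theta>)) * exp (2 * M)"
      unfolding M_def using \<eta>(1) by (intro always_eventually allI trajectory_dist_parameters \<theta> u t) auto
    have "(\<lambda>n. 2 * (norm (x0 (\<eta> n) - x0 \<theta>) + M * norm (\<eta> n - \<theta>)) * exp (2 * M))
      \<longlonglongrightarrow> 2 * (norm (x0 \<theta> - x0 \<theta>) + M * norm (\<theta> - \<theta>)) * exp (2 * M)"
      by (intro tendsto_intros x0_lim \<eta>(2))
    then show "(\<lambda>n. 2 * (norm (x0 (\<eta> n) - x0 \<theta>) + M * norm (\<eta> n - \<theta>)) * exp (2 * M)) \<longlonglongrightarrow> 0" by simp
  qed
  then show "(\<lambda>n. trajectory F0 F x0 u (\<eta> n) t) \<longlonglongrightarrow> trajectory F0 F x0 u \<theta> t" by (simp add: LIM_zero_iff)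
qed

text \<open>The perturbation is taken along the limit trajectory \<open>y\<close>: the drift
  cancels, and the factor \<open>F (y s) \<theta>\<close> does not depend on \<open>n\<close>, so a
  single constant from \<open>bilinear_integral_le_primitive\<close> covers the whole
  sequence.\<close>

lemma trajectory_tendsto:
  assumes \<theta>: "\<theta> \<in> \<Theta>" and u: "\<And>n. u n \<in> L2_controls" and C: "\<And>n. (L2_norm (u n))\<^sup>2 \<le> C" and v: "v \<in> L2_controls"
    and lim: "\<And>e. e > 0 \<Longrightarrow> \<exists>N. \<forall>n\<ge>N. \<forall>t\<in>{0..1}. norm (integral {0..t} (u n) - integral {0..t} v) \<le> e"
    and t: "t \<in> {0..1}"
  shows "(\<lambda>n. trajectory F0 F x0 (u n) \<theta> t) \<longlonglongrightarrow> trajectory F0 F x0 v \<theta> t"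
proof (rule LIMSEQ_I)
  fix r :: real assume "r > 0"
  define y where "y = trajectory F0 F x0 v \<theta>"
  note y = trajectory_integral_equation[OF \<theta> v, folded y_def]
  define Ex where "Ex = exp (2 * (K * (2 + C)))"
  \<comment> \<open>Bounds the L1 norm of \<open>u n - v\<close>, which is at most \<open>1\<close>
    plus the squared L2 norm; the parallelogram law bounds the latter by the bracket.\<close>
  define W where "W = 1 + (2 * C + 2 * (L2_norm v)\<^sup>2)"
  have C0: "C \<ge> 0" using C[of 0] by (rule order_trans[OF zero_le_power2])
  have Ex: "Ex > 0" by (simp add: Ex_def)
  have W: "W > 0" using C0 zero_le_power2[of "L2_norm v"] unfolding W_def by linarith
  \<comment> \<open>\<open>e\<close> here and \<open>\<delta>\<close> below are chosen so that each
    of the two terms of \<open>A\<close> adds at most \<open>r / 4\<close> to the final bound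
    \<open>2 * A * Ex\<close>.\<close>
  define e where "e = r / (8 * Ex * W)"
  have e: "e > 0" using \<open>r > 0\<close> Ex W by (simp add: e_def)
  have cF: "continuous_on {0..1} (\<lambda>s. F (y s) \<theta>)"
    using continuous_on_compose2[OF F_continuous[OF \<theta>] y(1)] by simp
  have bb: "bounded_bilinear ((*v) :: real^'k^'n \<Rightarrow> _)"
    using bilinear_matrix_vector_mult by (simp add: bilinear_conv_bounded_bilinear)
  obtain Kp where Kp: "Kp \<ge> 0" and Kp_le: "\<And>w \<delta> t. w absolutely_integrable_on {0..1} \<Longrightarrow>
       \<forall>s\<in>{0..1}. norm (integral {0..s} w) \<le> \<delta> \<Longrightarrow> t \<in> {0..1} \<Longrightarrow>
       norm (integral {0..t} (\<lambda>s. F (y s) \<theta> *v w s)) \<le> Kp * \<delta> + e * integral {0..1} (\<lambda>s. norm (w s))"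
    by (rule bilinear_integral_le_primitive[OF bb cF e]) (rule that)
  \<comment> \<open>\<open>Kp\<close> may be \<open>0\<close>, and \<open>\<delta>\<close> divides
    by this constant.\<close>
  define k where "k = Kp + 1"
  have k: "k > 0" "Kp \<le> k" using Kp by (simp_all add: k_def)
  define \<delta> where "\<delta> = r / (8 * Ex * k)"
  have \<delta>: "\<delta> > 0" using \<open>r > 0\<close> Ex k by (simp add: \<delta>_def)
  obtain N where N: "\<And>n t. n \<ge> N \<Longrightarrow> t \<in> {0..1} \<Longrightarrow> norm (integral {0..t} (u n) - integral {0..t} v) \<le> \<delta>"
    using lim[OF \<delta>] by blast
  define A where "A = Kp * \<delta> + e * W"
  have A0: "A \<ge> 0" using Kp \<delta> e W by (simp add: A_def)
  have "2 * A * Ex < r"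
  proof -
    have "2 * (e * W) * Ex = r / 4" using Ex W by (simp add: e_def field_simps)
    moreover have "2 * (Kp * \<delta>) * Ex \<le> r / 4"
    proof -
      have "Kp * (\<delta> * Ex) \<le> k * (\<delta> * Ex)" using k \<delta> Ex by (intro mult_right_mono) auto
      also have "\<dots> = r / 8" using k Ex by (simp add: \<delta>_def)
      finally show ?thesis by simp
    qed
    moreover have "2 * A * Ex = 2 * (Kp * \<delta>) * Ex + 2 * (e * W) * Ex" by (simp add: A_def algebra_simps)
    ultimately show ?thesis using \<open>r > 0\<close> by linarith
  qed
  show "\<exists>N. \<forall>n\<ge>N. norm (trajectory F0 F x0 (u n) \<theta> t - trajectory F0 F x0 v \<theta> t) < r"
  proof (intro exI[of _ N] allI impI)
    fix n assume n: "n \<ge> N"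
    define x where "x = trajectory F0 F x0 (u n) \<theta>"
    note x = trajectory_integral_equation[OF \<theta> u[of n], folded x_def]
    define w where "w s = u n s - v s" for s
    have wL: "w \<in> L2_controls" unfolding w_def[abs_def] by (rule L2_controls_diff[OF u v])
    have w_norm: "integral {0..1} (\<lambda>s. norm (w s)) \<le> W"
    proof -
      have "integral {0..1} (\<lambda>s. norm (w s)) \<le> 1 + (L2_norm w)\<^sup>2"
        using L2_controls_integral_norm_le[OF wL, of 1 0 1] by simp
      moreover have "(L2_norm w)\<^sup>2 \<le> 2 * (L2_norm (u n))\<^sup>2 + 2 * (L2_norm v)\<^sup>2"
        unfolding w_def[abs_def] using L2_norm_parallelogram[OF u[of n] v] zero_le_power2[of "L2_norm (\<lambda>t. u n t + v t)"]
        by linarith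
      ultimately show ?thesis using C[of n] unfolding W_def by linarith
    qed
    define \<rho> where "\<rho> s = integral {0..s} (\<lambda>s. F (y s) \<theta> *v w s)" for s
    have "norm (x t - y t) \<le> 2 * A * exp (2 * (K * (2 + (L2_norm (u n))\<^sup>2)))"
    proof (rule integral_equation_stability[OF \<theta> u A0 x(1) y(1) _ _ t, where \<rho> = \<rho>])
      fix s :: real assume s: "s \<in> {0..1}"
      have i: "(\<lambda>r. field (y r) \<theta> (u' r)) integrable_on {0..s}" if "u' \<in> L2_controls" for u'
        using field_integrable[OF \<theta> y(1) that] s
        by (auto simp: absolutely_integrable_on_def intro!: integrable_on_subinterval[of _ "{0..1}"])
      have "\<rho> s = integral {0..s} (\<lambda>r. field (y r) \<theta> (u n r) - field (y r) \<theta> (v r))"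
        unfolding \<rho>_def by (simp add: field_def w_def matrix_vector_mult_diff_distrib)
      also have "\<dots> = integral {0..s} (\<lambda>r. field (y r) \<theta> (u n r)) - integral {0..s} (\<lambda>r. field (y r) \<theta> (v r))"
        by (rule integral_diff[OF i[OF u] i[OF v]])
      finally show "x s - y s = \<rho> s + (integral {0..s} (\<lambda>s. field (x s) \<theta> (u n s)) - integral {0..s} (\<lambda>s. field (y s) \<theta> (u n s)))"
        unfolding x(2)[OF s] y(2)[OF s] by simp
      have "norm (\<rho> s) \<le> Kp * \<delta> + e * integral {0..1} (\<lambda>s. norm (w s))"
        unfolding \<rho>_def
      proof (rule Kp_le[OF L2_controls_integrable(3)[OF wL] _ s], rule ballI)
        fix s :: real assume s: "s \<in> {0..1}"
        have "integral {0..s} w = integral {0..s} (u n) - integral {0..s} v"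
          unfolding w_def using s by (intro integral_diff integrable_on_subinterval_unit u v) auto
        then show "norm (integral {0..s} w) \<le> \<delta>" using N[OF n s] by simp
      qed
      also have "\<dots> \<le> A" unfolding A_def using w_norm e by (intro add_left_mono mult_left_mono) auto
      finally show "norm (\<rho> s) \<le> A" .
    qed
    also have "\<dots> \<le> 2 * A * Ex"
      unfolding Ex_def using A0 K_pos C[of n] by (intro mult_left_mono) auto
    also have "\<dots> < r" by fact
    finally show "norm (trajectory F0 F x0 (u n) \<theta> t - trajectory F0 F x0 v \<theta> t) < r"
      by (simp add: x_def y_def)
  qed
qed

end

section \<open>The cost functional\<close>

locale optimal_control_problem = control_system \<Theta> F0 F x0 L
  for \<Theta> :: "'p::euclidean_space set"
    and F0 :: "real^'n \<Rightarrow> 'p \<Rightarrow> real^'n"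
    and F :: "real^'n \<Rightarrow> 'p \<Rightarrow> real^'k^'n"
    and x0 :: "'p \<Rightarrow> real^'n"
    and L :: real +
  fixes a :: "real \<Rightarrow> real^'n \<Rightarrow> 'p \<Rightarrow> real"
    and \<beta> :: real
    and \<nu> :: "real measure"
    and \<mu> :: "'p measure"
  assumes a_continuous: "continuous_on ({0..1} \<times> UNIV \<times> \<Theta>) (\<lambda>(t, x, \<theta>). a t x \<theta>)"
    and a_nonneg: "\<And>t x \<theta>. t \<in> {0..1} \<Longrightarrow> \<theta> \<in> \<Theta> \<Longrightarrow> a t x \<theta> \<ge> 0"
    and \<beta>_pos: "\<beta> > 0"
    and sets_\<nu>: "sets \<nu> = sets (restrict_space borel {0..1})" and prob_\<nu>: "prob_space \<nu>"
    and sets_\<mu>: "sets \<mu> = sets (restrict_space borel \<Theta>)" and prob_\<mu>: "prob_space \<mu>"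
begin

sublocale \<nu>: prob_space \<nu> by (rule prob_\<nu>)
sublocale \<mu>: prob_space \<mu> by (rule prob_\<mu>)

lemma space_\<nu>: "space \<nu> = {0..1}"
  using sets_eq_imp_space_eq[OF sets_\<nu>] by (simp add: space_restrict_space)

lemma space_\<mu>: "space \<mu> = \<Theta>"
  using sets_eq_imp_space_eq[OF sets_\<mu>] by (simp add: space_restrict_space)

definition state_cost :: "(real \<Rightarrow> real^'k) \<Rightarrow> 'p \<Rightarrow> real" where
  "state_cost u \<theta> = (LINT t|\<nu>. a t (trajectory F0 F x0 u \<theta> t) \<theta>)"

lemma cost_eq: "cost F0 F x0 a \<beta> \<nu> \<mu> u = integral\<^sup>L \<mu> (state_cost u) + \<beta> / 2 * (L2_norm u)\<^sup>2"
  by (simp add: cost_def state_cost_def[abs_def])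

lemma state_cost_nonneg: "\<theta> \<in> \<Theta> \<Longrightarrow> state_cost u \<theta> \<ge> 0"
  unfolding state_cost_def by (intro Bochner_Integration.integral_nonneg a_nonneg) (auto simp: space_\<nu>)

lemma a_tendsto:
  assumes "t \<in> {0..1}" "\<And>n. \<eta> n \<in> \<Theta>" "\<eta> \<longlonglongrightarrow> \<theta>" "\<theta> \<in> \<Theta>" "x \<longlonglongrightarrow> y"
  shows "(\<lambda>n. a t (x n) (\<eta> n)) \<longlonglongrightarrow> a t y \<theta>"
proof -
  have "(\<lambda>n. (t, x n, \<eta> n)) \<longlonglongrightarrow> (t, y, \<theta>)" by (intro tendsto_intros assms)
  moreover have "(t, x n, \<eta> n) \<in> {0..1} \<times> UNIV \<times> \<Theta>" for n using assms by auto
  moreover have "(t, y, \<theta>) \<in> {0..1} \<times> UNIV \<times> \<Theta>" using assms by auto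
  ultimately have "((\<lambda>(t, x, \<theta>). a t x \<theta>) \<circ> (\<lambda>n. (t, x n, \<eta> n))) \<longlonglongrightarrow> (\<lambda>(t, x, \<theta>). a t x \<theta>) (t, y, \<theta>)"
    by (intro a_continuous[unfolded continuous_on_sequentially, rule_format] conjI allI)
  then show ?thesis by (simp add: o_def)
qed

lemma running_cost_measurable:
  assumes u: "u \<in> L2_controls" and \<theta>: "\<theta> \<in> \<Theta>"
  shows "(\<lambda>t. a t (trajectory F0 F x0 u \<theta> t) \<theta>) \<in> borel_measurable \<nu>"
proof (rule borel_measurable_continuous_on_sets_eq[OF sets_\<nu>])
  have "continuous_on {0..1} (\<lambda>t. (t, trajectory F0 F x0 u \<theta> t, \<theta>))"
    by (intro continuous_intros trajectory_integral_equation(1) u \<theta>)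
  from continuous_on_compose2[OF a_continuous this] \<theta>
  show "continuous_on {0..1} (\<lambda>t. a t (trajectory F0 F x0 u \<theta> t) \<theta>)" by auto
qed

text \<open>\<open>a\<close> may be unbounded, but for controls in an L2 ball all trajectories stay
  in one closed ball, and \<open>a\<close> is bounded on the compact product of times, that ball and
  parameters.\<close>

lemma running_cost_bounded:
  obtains B where "\<And>u \<theta> t. u \<in> L2_controls \<Longrightarrow> (L2_norm u)\<^sup>2 \<le> C \<Longrightarrow> \<theta> \<in> \<Theta> \<Longrightarrow> t \<in> {0..1} \<Longrightarrow>
    a t (trajectory F0 F x0 u \<theta> t) \<theta> \<in> {0..B}"
proof -
  obtain R where R: "\<And>u \<theta> t. u \<in> L2_controls \<Longrightarrow> (L2_norm u)\<^sup>2 \<le> C \<Longrightarrow> \<theta> \<in> \<Theta> \<Longrightarrow> t \<in> {0..1} \<Longrightarrow>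
    norm (trajectory F0 F x0 u \<theta> t) \<le> R"
    by (rule trajectory_bounded[of C]) (rule that)
  have "compact ({0..1::real} \<times> cball (0::real^'n) R \<times> \<Theta>)"
    by (intro compact_Times compact_Icc compact_cball compact_\<Theta>)
  moreover have "continuous_on ({0..1} \<times> cball 0 R \<times> \<Theta>) (\<lambda>(t, x, \<theta>). a t x \<theta>)"
    using a_continuous by (rule continuous_on_subset) auto
  ultimately have "bounded ((\<lambda>(t, x, \<theta>). a t x \<theta>) ` ({0..1} \<times> cball 0 R \<times> \<Theta>))"
    by (intro compact_imp_bounded compact_continuous_image)
  then obtain B where "\<forall>z\<in>{0..1} \<times> cball 0 R \<times> \<Theta>. norm ((\<lambda>(t, x, \<theta>). a t x \<theta>) z) \<le> B"
    unfolding bounded_iff by blast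
  then have "a t x \<theta> \<le> B" if "t \<in> {0..1}" "norm x \<le> R" "\<theta> \<in> \<Theta>" for t x \<theta>
    using that by (force simp: abs_le_iff)
  then show ?thesis using R a_nonneg by (intro that[of B]) auto
qed

lemma state_cost_bounded:
  obtains B where "\<And>u \<theta>. u \<in> L2_controls \<Longrightarrow> (L2_norm u)\<^sup>2 \<le> C \<Longrightarrow> \<theta> \<in> \<Theta> \<Longrightarrow> \<bar>state_cost u \<theta>\<bar> \<le> B"
proof -
  obtain B where B: "\<And>u \<theta> t. u \<in> L2_controls \<Longrightarrow> (L2_norm u)\<^sup>2 \<le> C \<Longrightarrow> \<theta> \<in> \<Theta> \<Longrightarrow> t \<in> {0..1} \<Longrightarrow>
    a t (trajectory F0 F x0 u \<theta> t) \<theta> \<in> {0..B}"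
    by (rule running_cost_bounded[of C]) (rule that)
  have "state_cost u \<theta> \<le> B" if "u \<in> L2_controls" "(L2_norm u)\<^sup>2 \<le> C" "\<theta> \<in> \<Theta>" for u \<theta>
    unfolding state_cost_def
  proof (rule \<nu>.integral_le_const)
    show "integrable \<nu> (\<lambda>t. a t (trajectory F0 F x0 u \<theta> t) \<theta>)"
      using B[OF that] by (intro \<nu>.integrable_const_bound[of _ B] running_cost_measurable AE_I2 that) (auto simp: space_\<nu>)
    show "AE t in \<nu>. a t (trajectory F0 F x0 u \<theta> t) \<theta> \<le> B"
      using B[OF that] by (intro AE_I2) (auto simp: space_\<nu>)
  qed
  then show ?thesis using state_cost_nonneg by (intro that[of B]) auto
qed

text \<open>Measurability comes from continuity in the parameter, which is bounded convergence in
  time along a sequence of parameters.\<close>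

lemma state_cost_measurable:
  assumes u: "u \<in> L2_controls"
  shows "state_cost u \<in> borel_measurable \<mu>"
proof (rule borel_measurable_continuous_on_sets_eq[OF sets_\<mu>])
  obtain B where B: "\<And>\<theta> t. \<theta> \<in> \<Theta> \<Longrightarrow> t \<in> {0..1} \<Longrightarrow> a t (trajectory F0 F x0 u \<theta> t) \<theta> \<in> {0..B}"
    using running_cost_bounded[of "(L2_norm u)\<^sup>2"] u by (metis order_refl)
  show "continuous_on \<Theta> (state_cost u)"
    unfolding continuous_on_sequentially o_def
  proof (intro allI ballI impI, elim conjE)
    fix \<eta> :: "nat \<Rightarrow> 'p" and \<theta>
    assume \<theta>: "\<theta> \<in> \<Theta>" and \<eta>: "\<forall>n. \<eta> n \<in> \<Theta>" "\<eta> \<longlonglongrightarrow> \<theta>"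
    show "(\<lambda>n. state_cost u (\<eta> n)) \<longlonglongrightarrow> state_cost u \<theta>"
      unfolding state_cost_def
    proof (rule \<nu>.bounded_convergence[where B = B])
      show "(\<lambda>t. a t (trajectory F0 F x0 u (\<eta> n) t) (\<eta> n)) \<in> borel_measurable \<nu>" for n
        using running_cost_measurable[OF u] \<eta>(1) by blast
      fix t assume "t \<in> space \<nu>"
      then have t: "t \<in> {0..1}" by (simp add: space_\<nu>)
      show "\<bar>a t (trajectory F0 F x0 u (\<eta> n) t) (\<eta> n)\<bar> \<le> B" for n
        using B[of "\<eta> n" t] \<eta>(1) t by auto
      have "(\<lambda>n. trajectory F0 F x0 u (\<eta> n) t) \<longlonglongrightarrow> trajectory F0 F x0 u \<theta> t"
        using trajectory_continuous_parameter[OF u t] \<theta> \<eta>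
        unfolding continuous_on_sequentially o_def by blast
      then show "(\<lambda>n. a t (trajectory F0 F x0 u (\<eta> n) t) (\<eta> n)) \<longlonglongrightarrow> a t (trajectory F0 F x0 u \<theta> t) \<theta>"
        using t \<eta> \<theta> by (intro a_tendsto) auto
    qed
  qed
qed

text \<open>Bounded convergence is used twice, in time and then in the parameter. Pointwise
  convergence of the trajectories is enough for this; no uniformity in \<open>\<theta>\<close> or
  \<open>t\<close> enters.\<close>

lemma integral_state_cost_tendsto:
  assumes u: "\<And>n. u n \<in> L2_controls" and C: "\<And>n. (L2_norm (u n))\<^sup>2 \<le> C" and v: "v \<in> L2_controls"
    and lim: "\<And>e. e > 0 \<Longrightarrow> \<exists>N. \<forall>n\<ge>N. \<forall>t\<in>{0..1}. norm (integral {0..t} (u n) - integral {0..t} v) \<le> e"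
  shows "(\<lambda>n. integral\<^sup>L \<mu> (state_cost (u n))) \<longlonglongrightarrow> integral\<^sup>L \<mu> (state_cost v)"
proof -
  obtain B where B: "\<And>n \<theta>. \<theta> \<in> \<Theta> \<Longrightarrow> \<bar>state_cost (u n) \<theta>\<bar> \<le> B"
    using state_cost_bounded[of C] u C by metis
  obtain B' where B': "\<And>n \<theta> t. \<theta> \<in> \<Theta> \<Longrightarrow> t \<in> {0..1} \<Longrightarrow> a t (trajectory F0 F x0 (u n) \<theta> t) \<theta> \<in> {0..B'}"
    using running_cost_bounded[of C] u C by metis
  show ?thesis
  proof (rule \<mu>.bounded_convergence[where B = B])
    show "state_cost (u n) \<in> borel_measurable \<mu>" for n by (rule state_cost_measurable[OF u])
    fix \<theta> assume "\<theta> \<in> space \<mu>"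
    then have \<theta>: "\<theta> \<in> \<Theta>" by (simp add: space_\<mu>)
    show "\<bar>state_cost (u n) \<theta>\<bar> \<le> B" for n by (rule B[OF \<theta>])
    show "(\<lambda>n. state_cost (u n) \<theta>) \<longlonglongrightarrow> state_cost v \<theta>"
      unfolding state_cost_def
    proof (rule \<nu>.bounded_convergence[where B = B'])
      show "(\<lambda>t. a t (trajectory F0 F x0 (u n) \<theta> t) \<theta>) \<in> borel_measurable \<nu>" for n
        by (rule running_cost_measurable[OF u \<theta>])
      fix t assume "t \<in> space \<nu>"
      then have t: "t \<in> {0..1}" by (simp add: space_\<nu>)
      show "\<bar>a t (trajectory F0 F x0 (u n) \<theta> t) \<theta>\<bar> \<le> B'" for n
        using B'[OF \<theta> t, of n] by auto
      show "(\<lambda>n. a t (trajectory F0 F x0 (u n) \<theta> t) \<theta>) \<longlonglongrightarrow> a t (trajectory F0 F x0 v \<theta> t) \<theta>"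
        by (intro a_tendsto t \<theta> tendsto_const trajectory_tendsto[OF \<theta> u C v lim t])
    qed
  qed
qed

text \<open>Two extractions: the first makes the squared norms converge to some \<open>q\<close>,
  the second makes the controls converge. The state cost passes to the limit exactly, the norm only
  with an inequality, which points the right way because \<open>\<beta>\<close> is positive.\<close>

lemma cost_attains_infimum:
  "\<exists>v\<in>L2_controls. cost F0 F x0 a \<beta> \<nu> \<mu> v = (INF u\<in>L2_controls. cost F0 F x0 a \<beta> \<nu> \<mu> u)"
proof -
  define c where "c u = cost F0 F x0 a \<beta> \<nu> \<mu> u" for u
  define J where "J u = integral\<^sup>L \<mu> (state_cost u)" for u
  define I where "I = (INF u\<in>L2_controls. c u)"
  have c_eq: "c u = J u + \<beta> / 2 * (L2_norm u)\<^sup>2" for u by (simp add: c_def J_def cost_eq)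
  have J0: "J u \<ge> 0" for u
    unfolding J_def by (intro Bochner_Integration.integral_nonneg state_cost_nonneg) (simp add: space_\<mu>)
  have "c u \<ge> 0" for u
    unfolding c_eq using J0[of u] \<beta>_pos by (intro add_nonneg_nonneg mult_nonneg_nonneg) auto
  then have bdd: "bdd_below (c ` L2_controls)" by (rule bdd_belowI2)
  \<comment> \<open>On the reals \<open>INF\<close> is a genuine infimum only for a nonempty family
    bounded below; the zero control provides nonemptiness.\<close>
  have "(\<lambda>_. 0) \<in> L2_controls" by (simp add: L2_controls_def)
  then have ne: "L2_controls \<noteq> ({} :: (real \<Rightarrow> real^'k) set)" by blast
  have I_le: "I \<le> c u" if "u \<in> L2_controls" for u
    unfolding I_def using that by (intro cINF_lower bdd)
  have "\<exists>u\<in>L2_controls. c u < I + 1 / (real n + 1)" for n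
    using cINF_less_iff[OF ne bdd, of "I + 1 / (real n + 1)"] by (simp add: I_def)
  then obtain u where u: "\<And>n. u n \<in> L2_controls" and u_lt: "\<And>n. c (u n) < I + 1 / (real n + 1)" by metis
  have c_lim: "(\<lambda>n. c (u n)) \<longlonglongrightarrow> I"
  proof (rule tendsto_sandwich)
    show "\<forall>\<^sub>F n in sequentially. I \<le> c (u n)" "\<forall>\<^sub>F n in sequentially. c (u n) \<le> I + inverse (real (Suc n))"
      using I_le[OF u] u_lt less_imp_le by (auto intro!: always_eventually simp: inverse_eq_divide add.commute)
    show "(\<lambda>n. I + inverse (real (Suc n))) \<longlonglongrightarrow> I"
      using tendsto_add[OF tendsto_const LIMSEQ_inverse_real_of_nat] by simp
  qed simp
  \<comment> \<open>Coercivity: the state cost is nonnegative, so the quadratic term alone is at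
    most \<open>I + 1\<close> along the minimising sequence.\<close>
  define C where "C = 2 * (I + 1) / \<beta>"
  have C: "(L2_norm (u n))\<^sup>2 \<le> C" for n
  proof -
    have "1 / (real n + 1) \<le> 1" by simp
    then have "\<beta> / 2 * (L2_norm (u n))\<^sup>2 \<le> I + 1" using u_lt[of n] c_eq[of "u n"] J0[of "u n"] by linarith
    then show ?thesis using \<beta>_pos by (simp add: C_def field_simps)
  qed
  have "\<forall>n. (L2_norm (u n))\<^sup>2 \<in> {0..C}" using C by simp
  then obtain q s where s: "strict_mono (s :: nat \<Rightarrow> nat)" and q: "((\<lambda>n. (L2_norm (u n))\<^sup>2) \<circ> s) \<longlonglongrightarrow> q"
    using compact_imp_seq_compact[OF compact_Icc, of 0 C] by (metis (no_types, lifting) seq_compactE)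
  obtain r v where r: "strict_mono (r :: nat \<Rightarrow> nat)" and v: "v \<in> L2_controls" "(L2_norm v)\<^sup>2 \<le> q"
    and lim: "\<And>e. e > 0 \<Longrightarrow> \<exists>N. \<forall>n\<ge>N. \<forall>t\<in>{0..1}. norm (integral {0..t} (u (s (r n))) - integral {0..t} v) \<le> e"
    by (rule L2_weak_compactness[OF u q[unfolded o_def]]) (rule that)
  have "(\<lambda>n. J (u (s (r n)))) \<longlonglongrightarrow> J v"
    unfolding J_def by (rule integral_state_cost_tendsto[OF u C v(1) lim])
  moreover have "(\<lambda>n. (L2_norm (u (s (r n))))\<^sup>2) \<longlonglongrightarrow> q"
    using LIMSEQ_subseq_LIMSEQ[OF q r] by (simp add: o_def)
  ultimately have "(\<lambda>n. c (u (s (r n)))) \<longlonglongrightarrow> J v + \<beta> / 2 * q"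
    unfolding c_eq by (intro tendsto_intros)
  moreover have "(\<lambda>n. c (u (s (r n)))) \<longlonglongrightarrow> I"
    using LIMSEQ_subseq_LIMSEQ[OF LIMSEQ_subseq_LIMSEQ[OF c_lim s] r] by (simp add: o_def)
  ultimately have "I = J v + \<beta> / 2 * q" using LIMSEQ_unique by blast
  moreover have "\<beta> / 2 * (L2_norm v)\<^sup>2 \<le> \<beta> / 2 * q" using v(2) \<beta>_pos by (intro mult_left_mono) auto
  ultimately have "c v \<le> I" unfolding c_eq by linarith
  with I_le[OF v(1)] v(1) show ?thesis unfolding c_def I_def by (intro bexI[of _ v]) auto
qed

end

theorem theorem2p2:
  fixes \<Theta> :: "'p::euclidean_space set"
    and F0 :: "real^'n \<Rightarrow> 'p \<Rightarrow> real^'n"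
    and F :: "real^'n \<Rightarrow> 'p \<Rightarrow> real^'k^'n"
    and x0 :: "'p \<Rightarrow> real^'n"
    and a :: "real \<Rightarrow> real^'n \<Rightarrow> 'p \<Rightarrow> real"
    and L \<beta> :: real
    and \<nu> :: "real measure"
    and \<mu> :: "'p measure"
  assumes "compact \<Theta>"
    and "L > 0"
    and "\<And>x\<^sub>1 x\<^sub>2 \<theta>\<^sub>1 \<theta>\<^sub>2. \<theta>\<^sub>1 \<in> \<Theta> \<Longrightarrow> \<theta>\<^sub>2 \<in> \<Theta> \<Longrightarrow>
           norm (F0 x\<^sub>1 \<theta>\<^sub>1 - F0 x\<^sub>2 \<theta>\<^sub>2) \<le> L * (norm (x\<^sub>1 - x\<^sub>2) + norm (\<theta>\<^sub>1 - \<theta>\<^sub>2))"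
    and "\<And>i x\<^sub>1 x\<^sub>2 \<theta>\<^sub>1 \<theta>\<^sub>2. \<theta>\<^sub>1 \<in> \<Theta> \<Longrightarrow> \<theta>\<^sub>2 \<in> \<Theta> \<Longrightarrow>
           norm (column i (F x\<^sub>1 \<theta>\<^sub>1) - column i (F x\<^sub>2 \<theta>\<^sub>2))
             \<le> L * (norm (x\<^sub>1 - x\<^sub>2) + norm (\<theta>\<^sub>1 - \<theta>\<^sub>2))"
    and "continuous_on \<Theta> x0"
    and "continuous_on ({0..1} \<times> UNIV \<times> \<Theta>) (\<lambda>(t, x, \<theta>). a t x \<theta>)"
    and "\<And>t x \<theta>. t \<in> {0..1} \<Longrightarrow> \<theta> \<in> \<Theta> \<Longrightarrow> a t x \<theta> \<ge> 0"
    and "\<beta> > 0"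
    and "sets \<nu> = sets (restrict_space borel {0..1})" and "prob_space \<nu>"
    and "sets \<mu> = sets (restrict_space borel \<Theta>)" and "prob_space \<mu>"
  shows "\<exists>u\<^sub>0 \<in> L2_controls.
           cost F0 F x0 a \<beta> \<nu> \<mu> u\<^sub>0 = (INF u \<in> L2_controls. cost F0 F x0 a \<beta> \<nu> \<mu> u)"
proof -
  interpret optimal_control_problem \<Theta> F0 F x0 L a \<beta> \<nu> \<mu>
    by (intro optimal_control_problem.intro control_system.intro optimal_control_problem_axioms.intro) (fact assms)+
  show ?thesis by (rule cost_attains_infimum)
qed

end
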